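(* Consider the mimetic finite difference discretization and the $\theta$-scheme with renormalization described in the context (simplified Landau-Lifshitz equation $\partial_t \mathbf{m} = -\mathbf{m}\times\Delta\mathbf{m} - \alpha\,\mathbf{m}\times(\mathbf{m}\times\Delta\mathbf{m})$, $\alpha>0$, with homogeneous Neumann boundary conditions), with $\theta=0$ (explicit scheme) or $\theta=1$ (implicit scheme). Assume that the mesh $\Omega^h$ is shape regular and quasi-uniform, and that for every element $E\in\Omega^h$: (a) $\mathbb{M}_{\mathcal{F},E}^{-1}$ is an M-matrix, and (b) the vector $\mathbb{M}_{\mathcal{F},E}^{-1}\,\mathbb{C}_E\,\mathbf{e}$ has positive entries. Let $C_1>0$ be the constant (independent of $h$ and $\mathbf{v}^h$) in the inverse estimate $$\|\mathcal{GRAD}\,\mathbf{v}^h\|_{\mathcal{F}}^2\le \frac{C_1}{h^2}\|\mathbf{v}^h\|_{\mathcal{Q}}^2\qquad\text{for all }\mathbf{v}^h\in(\mathcal{Q}^h)^3 .$$ If $\theta=0$, assume in addition the Courant condition $$\frac{k}{h^2}\le \frac{2\alpha}{C_1(1+\alpha^2)} .$$ Then for every time moment $t^j=jk$ the iterates satisfy $$\|\mathcal{GRAD}\,\mathbf{m}^{j+1}\|_{\mathcal{F}}\le\|\mathcal{GRAD}\,\mathbf{m}^{j}\|_{\mathcal{F}} .$$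
   Context: **Mesh.** $\Omega\subset\mathbb{R}^d$, $d\in\{2,3\}$, is a bounded domain decomposed into $N_E$ non-overlapping polygonal ($d=2$) or polyhedral ($d=3$) elements $E$; the mesh is $\Omega^h$ and $h$ is the maximum element diameter. "Faces" $f$ means mesh edges if $d=2$ and mesh faces if $d=3$. $|E|$ and $|f|$ are the $d$- and $(d-1)$-dimensional measures, and $\mathbf{n}_E$ is the outward unit normal on $\partial E$. The mesh is regarded as a member of a family indexed by $h$. Shape regular is meant in the usual sense for polytopal meshes (each element can be split into a uniformly bounded number of uniformly shape-regular simplices, compatibly with the mesh faces); quasi-uniform means that the diameters of all elements are bounded below by a fixed positive multiple of $h$. "Independent of $h$" means uniform over the family. **Discrete spaces.** $\mathcal{Q}^h$ is the space of vectors $v_u=(v_{u,E})_{E\in\Omega^h}$ with one real value per element. A discrete magnetization is $\mathbf{m}=(m_x,m_y,m_z)\in(\mathcal{Q}^h)^3$, and $\mathbf{m}_E=(m_{x,E},m_{y,E},m_{z,E})\in\mathbb{R}^3$. $\mathcal{F}^h$ is the space of vectors $p_u=(p_{u,E,f})$ with one real value per pair (element $E$, face $f\subset\partial E$), representing mean outward normal fluxes, subject to flux continuity $p_{u,E_1,f}+p_{u,E_2,f}=0$ on each internal face $f$ shared by $E_1,E_2$, and, because of the homogeneous Neumann condition, $p_{u,E,f}=0$ on each boundary face. A discrete flux is $\mathbf{p}=(p_x,p_y,p_z)\in(\mathcal{F}^h)^3$. For an element $E$ with $n$ faces, $p_{u,E}\in\mathbb{R}^n$ is the vector of the values of $p_u$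 on $E$. **Inner products.** $[\mathbf{m},\mathbf{w}]_{\mathcal{Q}}=\sum_{u\in\{x,y,z\}}\sum_{E}|E|\,m_{u,E}w_{u,E}$ and $[\mathbf{p},\mathbf{q}]_{\mathcal{F}}=\sum_{u\in\{x,y,z\}}\sum_E p_{u,E}^T\,\mathbb{M}_{\mathcal{F},E}\,q_{u,E}$, with induced norms $\|\cdot\|_{\mathcal{Q}}$, $\|\cdot\|_{\mathcal{F}}$. Each $\mathbb{M}_{\mathcal{F},E}$ is a symmetric positive definite $n\times n$ matrix satisfying the consistency condition $\mathbb{M}_{\mathcal{F},E}\mathbb{N}=\mathbb{R}$, where the row of $\mathbb{N}$ corresponding to face $f$ is the outward unit normal to $f$ and the corresponding row of $\mathbb{R}$ is $|f|$ times (centroid of $f$ minus centroid of $E$), and the stability condition: there are constants $c_0,C_0>0$ independent of $h$ and $E$ with $c_0|E|\,q^Tq\le q^T\mathbb{M}_{\mathcal{F},E}\,q\le C_0|E|\,q^Tq$ for all $q\in\mathbb{R}^n$. For an element $E$ with faces $f_1,\dots,f_n$, $\mathbb{C}_E=\mathrm{diag}\{|f_1|,\dots,|f_n|\}$ and $\mathbf{e}=(1,\dots,1)^T\in\mathbb{R}^n$. An M-matrix is a nonsingular matrix with nonpositive off-diagonal entries and entrywise nonnegative inverse. **Mimetic operators.** The discrete divergence is $(\mathcal{DIV}\,p_u)_E=\frac{1}{|E|}\sum_{f\subset\partial E}|f|\,p_{u,E,f}$, applied componentwise to $\mathbf{p}$; $(\mathcal{DIV}\,\mathbf{p})_E\in\mathbb{R}^3$.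 The mimetic gradient $\mathcal{GRAD}:(\mathcal{Q}^h)^3\to(\mathcal{F}^h)^3$ is the unique linear map with $[\mathbf{m},\mathcal{DIV}\,\mathbf{p}]_{\mathcal{Q}}=-[\mathcal{GRAD}\,\mathbf{m},\mathbf{p}]_{\mathcal{F}}$ for all $\mathbf{m}\in(\mathcal{Q}^h)^3$, $\mathbf{p}\in(\mathcal{F}^h)^3$. **Algorithm ($\theta$-scheme with renormalization).** Let $k>0$ be the time step and $\mathbf{m}^0\in(\mathcal{Q}^h)^3$ with $|\mathbf{m}^0_E|=1$ for all $E$ ($|\cdot|$ is the Euclidean norm). Given $\mathbf{m}^j$, the step $j\to j+1$ is: (i) find $\hat{\mathbf{m}}^{j+1}\in(\mathcal{Q}^h)^3$ such that, with $\mathbf{p}^{j+\theta}=-\mathcal{GRAD}\big(\mathbf{m}^j+\theta(\hat{\mathbf{m}}^{j+1}-\mathbf{m}^j)\big)$, for every $E$, $$\frac{\hat{\mathbf{m}}^{j+1}_E-\mathbf{m}^j_E}{k}+\alpha(\mathcal{DIV}\,\mathbf{p}^{j+\theta})_E=\mathbf{m}^j_E\times(\mathcal{DIV}\,\mathbf{p}^{j+\theta})_E+\alpha\big(\mathbf{m}^j_E\cdot(\mathcal{DIV}\,\mathbf{p}^{j+\theta})_E\big)\mathbf{m}^j_E ;$$ (ii) set $\mathbf{m}^{j+1}_E=\hat{\mathbf{m}}^{j+1}_E/|\hat{\mathbf{m}}^{j+1}_E|$ for every $E$. *)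

theory Defs
  imports "HOL-Analysis.Analysis" "HOL-Analysis.Cross3"
begin

section \<open>Matrices and vectors indexed by a finite set\<close>

text \<open>The number of faces varies from element to element, so the local matrices are functions
  \<open>'f \<Rightarrow> 'f \<Rightarrow> real\<close> of which only the entries with both indices in a finite set \<open>I\<close> matter.\<close>

definition matvec_on :: "'f set \<Rightarrow> ('f \<Rightarrow> 'f \<Rightarrow> real) \<Rightarrow> ('f \<Rightarrow> real) \<Rightarrow> 'f \<Rightarrow> real" where
  "matvec_on I A x = (\<lambda>f. \<Sum>g\<in>I. A f g * x g)"

definition dot_on :: "'f set \<Rightarrow> ('f \<Rightarrow> real) \<Rightarrow> ('f \<Rightarrow> real) \<Rightarrow> real" where
  "dot_on I x y = (\<Sum>f\<in>I. x f * y f)"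

definition diag_matrix :: "('f \<Rightarrow> real) \<Rightarrow> 'f \<Rightarrow> 'f \<Rightarrow> real" where
  "diag_matrix x = (\<lambda>f g. if f = g then x f else 0)"

definition inverses_on :: "'f set \<Rightarrow> ('f \<Rightarrow> 'f \<Rightarrow> real) \<Rightarrow> ('f \<Rightarrow> 'f \<Rightarrow> real) \<Rightarrow> bool" where
  "inverses_on I A B \<longleftrightarrow>
     (\<forall>f\<in>I. \<forall>g\<in>I. (\<Sum>l\<in>I. A f l * B l g) = (if f = g then 1 else 0) \<and>
                 (\<Sum>l\<in>I. B f l * A l g) = (if f = g then 1 else 0))"

definition nonsingular_on :: "'f set \<Rightarrow> ('f \<Rightarrow> 'f \<Rightarrow> real) \<Rightarrow> bool" where
  "nonsingular_on I A \<longleftrightarrow> (\<exists>B. inverses_on I A B)"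

text \<open>As for \<^const>\<open>matrix_inv\<close>; the entries with indices in \<open>I\<close> are uniquely determined.\<close>

definition inverse_on :: "'f set \<Rightarrow> ('f \<Rightarrow> 'f \<Rightarrow> real) \<Rightarrow> 'f \<Rightarrow> 'f \<Rightarrow> real" where
  "inverse_on I A = (SOME B. inverses_on I A B)"

definition M_matrix_on :: "'f set \<Rightarrow> ('f \<Rightarrow> 'f \<Rightarrow> real) \<Rightarrow> bool" where
  "M_matrix_on I A \<longleftrightarrow>
     nonsingular_on I A \<and>
     (\<forall>f\<in>I. \<forall>g\<in>I. f \<noteq> g \<longrightarrow> A f g \<le> 0) \<and>
     (\<forall>f\<in>I. \<forall>g\<in>I. 0 \<le> inverse_on I A f g)"

definition spd_on :: "'f set \<Rightarrow> ('f \<Rightarrow> 'f \<Rightarrow> real) \<Rightarrow> bool" where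
  "spd_on I A \<longleftrightarrow>
     (\<forall>f\<in>I. \<forall>g\<in>I. A f g = A g f) \<and>
     (\<forall>x. (\<exists>f\<in>I. x f \<noteq> 0) \<longrightarrow> 0 < dot_on I x (matvec_on I A x))"


section \<open>Measure and centroid of elements and faces\<close>

text \<open>For a unit vector \<open>n\<close>, this is the \<open>(d-1)\<close>-dimensional Lebesgue measure on the hyperplane
  \<open>n \<bullet> x = b\<close>: the measure of a set is the volume of the right prism of height 1 over it.\<close>

definition hyperplane_measure :: "'a::euclidean_space \<Rightarrow> real \<Rightarrow> 'a measure" where
  "hyperplane_measure n b =
     distr (restrict_space lborel {x. b \<le> n \<bullet> x \<and> n \<bullet> x \<le> b + 1}) borel
           (\<lambda>x. x - (n \<bullet> x - b) *\<^sub>R n)"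

text \<open>A face spans a hyperplane, so the pair \<open>(n, b)\<close> is determined up to sign, and the
  restriction of the measure to the hyperplane does not depend on the sign.\<close>

definition face_measure :: "'a::euclidean_space set \<Rightarrow> 'a measure" where
  "face_measure f =
     (let (n, b) = (SOME (n, b). norm n = 1 \<and> (\<forall>x\<in>f. n \<bullet> x = b)) in hyperplane_measure n b)"

definition face_area :: "'a::euclidean_space set \<Rightarrow> real" where
  "face_area f = measure (face_measure f) f"

definition face_centroid :: "'a::euclidean_space set \<Rightarrow> 'a" where
  "face_centroid f = (1 / face_area f) *\<^sub>R (LINT x:f|face_measure f. x)"

definition elem_volume :: "'a::euclidean_space set \<Rightarrow> real" where
  "elem_volume E = measure lborel E"

definition centroid :: "'a::euclidean_space set \<Rightarrow> 'a" where
  "centroid E = (1 / elem_volume E) *\<^sub>R (LINT x:E|lborel. x)"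

definition outward_unit_normal_at :: "'a::euclidean_space set \<Rightarrow> 'a set \<Rightarrow> 'a \<Rightarrow> 'a \<Rightarrow> bool" where
  "outward_unit_normal_at E f x n \<longleftrightarrow>
     norm n = 1 \<and> (\<forall>y\<in>f. \<forall>z\<in>f. n \<bullet> (y - z) = 0) \<and>
     (\<exists>\<epsilon>>0. \<forall>t. 0 < t \<and> t < \<epsilon> \<longrightarrow> x - t *\<^sub>R n \<in> E \<and> x + t *\<^sub>R n \<notin> E)"

text \<open>Outwardness is not required at every point of the relative interior: there, the
  boundary of a non-convex element may touch the face at exceptional points.\<close>

definition outward_unit_normal :: "'a::euclidean_space set \<Rightarrow> 'a set \<Rightarrow> 'a \<Rightarrow> bool" where
  "outward_unit_normal E f n \<longleftrightarrow> (\<exists>x\<in>rel_interior f. outward_unit_normal_at E f x n)"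

definition face_normal :: "'a::euclidean_space set \<Rightarrow> 'a set \<Rightarrow> 'a" where
  "face_normal E f = (THE n. outward_unit_normal E f n)"


section \<open>Polytopal meshes\<close>

text \<open>A \<open>k\<close>-dimensional flat polytopal cell, not necessarily convex: for \<open>k = 1\<close> a segment,
  for \<open>k = 2\<close> a planar polygon, for \<open>k = 3\<close> a polyhedron.\<close>

definition polytopal_cell :: "int \<Rightarrow> 'a::euclidean_space set \<Rightarrow> bool" where
  "polytopal_cell k S \<longleftrightarrow>
     aff_dim S = k \<and> connected (rel_interior S) \<and>
     (\<exists>\<T>. finite \<T> \<and> \<T> \<noteq> {} \<and> (\<forall>\<sigma>\<in>\<T>. k simplex \<sigma>) \<and> S = \<Union>\<T>)"

text \<open>The faces are part of the data: a flat piece of the boundary of an element may consist of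
  several mesh faces.\<close>

record 'a mesh =
  elems :: "'a set set"
  faces :: "'a set \<Rightarrow> 'a set set"

definition bounded_domain :: "'a::euclidean_space set \<Rightarrow> bool" where
  "bounded_domain \<Omega> \<longleftrightarrow> open \<Omega> \<and> connected \<Omega> \<and> bounded \<Omega> \<and> \<Omega> \<noteq> {}"

definition polytopal_mesh :: "'a::euclidean_space set \<Rightarrow> 'a mesh \<Rightarrow> bool" where
  "polytopal_mesh \<Omega> T \<longleftrightarrow>
     finite (elems T) \<and> elems T \<noteq> {} \<and> \<Union>(elems T) = closure \<Omega> \<and>
     (\<forall>E\<in>elems T. polytopal_cell (int DIM('a)) E \<and> interior E \<subseteq> \<Omega>) \<and>
     (\<forall>E1\<in>elems T. \<forall>E2\<in>elems T. E1 \<noteq> E2 \<longrightarrow> interior E1 \<inter> interior E2 = {}) \<and>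
     (\<forall>E\<in>elems T. finite (faces T E) \<and> \<Union>(faces T E) = frontier E \<and>
        (\<forall>f\<in>faces T E. polytopal_cell (int DIM('a) - 1) f \<and> (\<exists>!n. outward_unit_normal E f n))) \<and>
     (\<forall>E1\<in>elems T. \<forall>E2\<in>elems T. \<forall>f\<in>faces T E1. \<forall>g\<in>faces T E2.
        f \<noteq> g \<longrightarrow> rel_interior f \<inter> rel_interior g = {}) \<and>
     (\<forall>E\<in>elems T. \<forall>f\<in>faces T E.
        f \<subseteq> frontier \<Omega> \<or>
        (rel_interior f \<subseteq> \<Omega> \<and> card {E'\<in>elems T. f \<in> faces T E'} = 2))"

definition mesh_size :: "'a::euclidean_space mesh \<Rightarrow> real" where
  "mesh_size T = Max (diameter ` elems T)"

definition shape_regular_family :: "'a::euclidean_space mesh set \<Rightarrow> bool" where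
  "shape_regular_family \<M> \<longleftrightarrow>
     (\<exists>N::nat. \<exists>\<rho>>0. \<forall>T\<in>\<M>. \<forall>E\<in>elems T. \<exists>\<T>.
        triangulation \<T> \<and> card \<T> \<le> N \<and> \<Union>\<T> = E \<and>
        (\<forall>\<sigma>\<in>\<T>. int DIM('a) simplex \<sigma> \<and> (\<exists>x. cball x (\<rho> * diameter \<sigma>) \<subseteq> \<sigma>)) \<and>
        (\<forall>f\<in>faces T E. f = \<Union>{g. g \<subseteq> f \<and> (\<exists>\<sigma>\<in>\<T>. g facet_of \<sigma>)}))"

definition quasi_uniform_family :: "'a::euclidean_space mesh set \<Rightarrow> bool" where
  "quasi_uniform_family \<M> \<longleftrightarrow>
     (\<exists>c>0. \<forall>T\<in>\<M>. \<forall>E\<in>elems T. c * mesh_size T \<le> diameter E)"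


section \<open>Discrete spaces, inner products and mimetic operators\<close>

text \<open>Discrete functions are extended by \<open>0\<close> outside the mesh. A discrete magnetization
  \<open>m \<in> (\<Q>\<^sup>h)\<^sup>3\<close> is stored as \<open>m E $ u\<close>, a discrete flux \<open>p \<in> (\<F>\<^sup>h)\<^sup>3\<close> as \<open>p E f $ u\<close>.\<close>

definition Qh :: "'a mesh \<Rightarrow> ('a set \<Rightarrow> real) set" where
  "Qh T = {v. \<forall>E. E \<notin> elems T \<longrightarrow> v E = 0}"

definition Fh :: "'a::euclidean_space set \<Rightarrow> 'a mesh \<Rightarrow> ('a set \<Rightarrow> 'a set \<Rightarrow> real) set" where
  "Fh \<Omega> T = {p.
     (\<forall>E f. \<not> (E \<in> elems T \<and> f \<in> faces T E) \<longrightarrow> p E f = 0) \<and>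
     (\<forall>E1\<in>elems T. \<forall>E2\<in>elems T. E1 \<noteq> E2 \<longrightarrow>
        (\<forall>f\<in>faces T E1 \<inter> faces T E2. p E1 f + p E2 f = 0)) \<and>
     (\<forall>E\<in>elems T. \<forall>f\<in>faces T E. f \<subseteq> frontier \<Omega> \<longrightarrow> p E f = 0)}"

definition Qh3 :: "'a mesh \<Rightarrow> ('a set \<Rightarrow> real^3) set" where
  "Qh3 T = {m. \<forall>u. (\<lambda>E. m E $ u) \<in> Qh T}"

definition Fh3 :: "'a::euclidean_space set \<Rightarrow> 'a mesh \<Rightarrow> ('a set \<Rightarrow> 'a set \<Rightarrow> real^3) set" where
  "Fh3 \<Omega> T = {p. \<forall>u. (\<lambda>E f. p E f $ u) \<in> Fh \<Omega> T}"

definition innerQ ::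
    "'a::euclidean_space mesh \<Rightarrow> ('a set \<Rightarrow> real^3) \<Rightarrow> ('a set \<Rightarrow> real^3) \<Rightarrow> real" where
  "innerQ T m w = (\<Sum>u\<in>UNIV. \<Sum>E\<in>elems T. elem_volume E * (m E $ u) * (w E $ u))"

definition innerF ::
    "'a mesh \<Rightarrow> ('a set \<Rightarrow> 'a set \<Rightarrow> 'a set \<Rightarrow> real) \<Rightarrow>
     ('a set \<Rightarrow> 'a set \<Rightarrow> real^3) \<Rightarrow> ('a set \<Rightarrow> 'a set \<Rightarrow> real^3) \<Rightarrow> real" where
  "innerF T M p q = (\<Sum>u\<in>UNIV. \<Sum>E\<in>elems T.
     dot_on (faces T E) (\<lambda>f. p E f $ u) (matvec_on (faces T E) (M E) (\<lambda>f. q E f $ u)))"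

definition normQ :: "'a::euclidean_space mesh \<Rightarrow> ('a set \<Rightarrow> real^3) \<Rightarrow> real" where
  "normQ T m = sqrt (innerQ T m m)"

definition normF ::
    "'a mesh \<Rightarrow> ('a set \<Rightarrow> 'a set \<Rightarrow> 'a set \<Rightarrow> real) \<Rightarrow>
     ('a set \<Rightarrow> 'a set \<Rightarrow> real^3) \<Rightarrow> real" where
  "normF T M p = sqrt (innerF T M p p)"

text \<open>\<open>M E f g\<close> is the entry of the local matrix of \<open>E\<close> for the faces \<open>f\<close> and \<open>g\<close>. The last
  condition is \<open>\<M>\<^bsub>E\<^esub> \<N> = \<R>\<close>, stated row by row.\<close>

definition mimetic_matrices ::
    "'a::euclidean_space mesh \<Rightarrow> ('a set \<Rightarrow> 'a set \<Rightarrow> 'a set \<Rightarrow> real) \<Rightarrow> bool" where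
  "mimetic_matrices T M \<longleftrightarrow>
     (\<forall>E\<in>elems T. spd_on (faces T E) (M E) \<and>
        (\<forall>f\<in>faces T E. (\<Sum>g\<in>faces T E. M E f g *\<^sub>R face_normal E g) =
                        face_area f *\<^sub>R (face_centroid f - centroid E)))"

definition stable_matrices ::
    "real \<Rightarrow> real \<Rightarrow> 'a::euclidean_space mesh \<Rightarrow> ('a set \<Rightarrow> 'a set \<Rightarrow> 'a set \<Rightarrow> real) \<Rightarrow> bool" where
  "stable_matrices c0 C0 T M \<longleftrightarrow>
     (\<forall>E\<in>elems T. \<forall>q.
        c0 * elem_volume E * dot_on (faces T E) q q
          \<le> dot_on (faces T E) q (matvec_on (faces T E) (M E) q) \<and>
        dot_on (faces T E) q (matvec_on (faces T E) (M E) q)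
          \<le> C0 * elem_volume E * dot_on (faces T E) q q)"

definition area_matrix :: "'a::euclidean_space set \<Rightarrow> 'a set \<Rightarrow> real" where
  "area_matrix = diag_matrix face_area"

definition DIV ::
    "'a::euclidean_space mesh \<Rightarrow> ('a set \<Rightarrow> 'a set \<Rightarrow> real^3) \<Rightarrow> 'a set \<Rightarrow> real^3" where
  "DIV T p = (\<lambda>E. if E \<in> elems T
     then (1 / elem_volume E) *\<^sub>R (\<Sum>f\<in>faces T E. face_area f *\<^sub>R p E f) else 0)"

definition GRAD ::
    "'a::euclidean_space set \<Rightarrow> 'a mesh \<Rightarrow> ('a set \<Rightarrow> 'a set \<Rightarrow> 'a set \<Rightarrow> real) \<Rightarrow>
     ('a set \<Rightarrow> real^3) \<Rightarrow> 'a set \<Rightarrow> 'a set \<Rightarrow> real^3" where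
  "GRAD \<Omega> T M m = (THE p. p \<in> Fh3 \<Omega> T \<and>
     (\<forall>q\<in>Fh3 \<Omega> T. innerQ T m (DIV T q) = - innerF T M p q))"


section \<open>The mimetic gradient is well defined and linear\<close>

lemma spd_solvable:
  assumes "finite I" "\<forall>f\<in>I. \<forall>g\<in>I. A f g = A g f"
    and "\<forall>x. (\<exists>f\<in>I. x f \<noteq> 0) \<longrightarrow> 0 < dot_on I x (matvec_on I A x)"
  shows "\<exists>x. \<forall>f\<in>I. matvec_on I A x f = (b f :: real)"
  using assms
proof (induction I arbitrary: b rule: finite_induct)
  case (insert a I)
  have pos: "0 < dot_on I x (matvec_on I A x)" if "\<exists>f\<in>I. x f \<noteq> 0" for x
  proof -
    let ?x = "\<lambda>f. if f \<in> I then x f else 0"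
    have "0 < dot_on (insert a I) ?x (matvec_on (insert a I) A ?x)"
      using that insert.prems(2) by auto
    also have "\<dots> = dot_on I ?x (matvec_on I A ?x)"
      using insert.hyps by (simp add: dot_on_def matvec_on_def)
    also have "\<dots> = dot_on I x (matvec_on I A x)"
      by (simp add: dot_on_def matvec_on_def)
    finally show ?thesis .
  qed
  have sym: "\<forall>f\<in>I. \<forall>g\<in>I. A f g = A g f"
    using insert.prems(1) by auto
  note IH = insert.IH[OF sym] 
  obtain w where w: "\<forall>f\<in>I. matvec_on I A w f = A f a"
    using IH[of "\<lambda>f. A f a"] pos by auto
  obtain y where y: "\<forall>f\<in>I. matvec_on I A y f = b f"
    using IH[of b] pos by auto
  define s where "s = A a a - (\<Sum>f\<in>I. A a f * w f)"
  let ?z = "\<lambda>f. if f \<in> I then w f else - 1"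
  have cong: "(\<Sum>f\<in>I. g f * ?z f) = (\<Sum>f\<in>I. g f * w f)" for g
    by (intro sum.cong) auto
  have zI: "matvec_on (insert a I) A ?z f = 0" if "f \<in> I" for f
    using w insert.hyps that by (simp add: matvec_on_def cong)
  have za: "matvec_on (insert a I) A ?z a = - s"
    using insert.hyps by (simp add: matvec_on_def s_def cong)
  have "dot_on (insert a I) ?z (matvec_on (insert a I) A ?z) = s"
    using insert.hyps zI za by (simp add: dot_on_def)
  moreover have "0 < dot_on (insert a I) ?z (matvec_on (insert a I) A ?z)"
    using insert.prems(2)[rule_format, of ?z] insert.hyps by auto
  ultimately have s: "s > 0" by simp
  define t where "t = (b a - (\<Sum>f\<in>I. A a f * y f)) / s"
  define x where "x = (\<lambda>f. if f \<in> I then y f - t * w f else t)"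
  have sx: "(\<Sum>f\<in>I. g f * x f) = (\<Sum>f\<in>I. g f * y f) - t * (\<Sum>f\<in>I. g f * w f)" for g
  proof -
    have "(\<Sum>f\<in>I. g f * x f) = (\<Sum>f\<in>I. g f * y f - t * (g f * w f))"
      by (intro sum.cong) (auto simp: x_def algebra_simps)
    thus ?thesis by (simp add: sum_subtractf sum_distrib_left)
  qed
  have xa: "x a = t" using insert.hyps by (simp add: x_def)
  have "matvec_on (insert a I) A x f = b f" if "f \<in> insert a I" for f
  proof (cases "f \<in> I")
    case True
    have "matvec_on (insert a I) A x f = A f a * t + (\<Sum>g\<in>I. A f g * x g)"
      using insert.hyps xa by (simp add: matvec_on_def)
    also have "\<dots> = A f a * t + (b f - t * A f a)"
      using True w y by (simp add: sx matvec_on_def)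
    finally show ?thesis by simp
  next
    case False
    hence f: "f = a" using that by auto
    have "matvec_on (insert a I) A x f = A a a * t + (\<Sum>g\<in>I. A a g * x g)"
      using insert.hyps xa f by (simp add: matvec_on_def)
    also have "\<dots> = (\<Sum>f\<in>I. A a f * y f) + t * s"
    proof -
      have "A a a * t + (Y - t * W) = Y + t * (A a a - W)" for Y W :: real
        by (simp add: algebra_simps)
      thus ?thesis unfolding sx s_def .
    qed
    also have "\<dots> = b a" using s by (simp add: t_def)
    finally show ?thesis using f by simp
  qed
  thus ?case by blast
qed auto


lemma spd_on_pos:
  "spd_on I A \<Longrightarrow> \<exists>f\<in>I. x f \<noteq> 0 \<Longrightarrow> 0 < dot_on I x (matvec_on I A x)"
  unfolding spd_on_def by (elim conjE allE[of _ x] impE)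

lemma spd_on_nonneg:
  assumes "spd_on I A"
  shows "0 \<le> dot_on I x (matvec_on I A x)"
proof (cases "\<exists>f\<in>I. x f \<noteq> 0")
  case True
  thus ?thesis by (rule less_imp_le[OF spd_on_pos[OF assms]])
next
  case False
  hence "dot_on I x (matvec_on I A x) = 0"
    unfolding dot_on_def by (intro sum.neutral) auto
  thus ?thesis by simp
qed

lemma riesz_Fh:
  fixes r :: "'a::euclidean_space set \<Rightarrow> 'a set \<Rightarrow> real"
  assumes mesh: "polytopal_mesh \<Omega> T"
    and spd: "\<And>E. E \<in> elems T \<Longrightarrow> spd_on (faces T E) (M E)"
  shows "\<exists>p\<in>Fh \<Omega> T. \<forall>q\<in>Fh \<Omega> T.
    (\<Sum>E\<in>elems T. dot_on (faces T E) (p E) (matvec_on (faces T E) (M E) (q E))) =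
    (\<Sum>E\<in>elems T. dot_on (faces T E) (r E) (q E))"
proof -
  have finE: "finite (elems T)" and finF: "\<And>E. E \<in> elems T \<Longrightarrow> finite (faces T E)"
    using mesh by (auto simp: polytopal_mesh_def)
  have two: "card {E'\<in>elems T. f \<in> faces T E'} = 2"
    if "E \<in> elems T" "f \<in> faces T E" "\<not> f \<subseteq> frontier \<Omega>" for E f
  proof -
    have "\<forall>E\<in>elems T. \<forall>f\<in>faces T E. f \<subseteq> frontier \<Omega> \<or>
            (rel_interior f \<subseteq> \<Omega> \<and> card {E'\<in>elems T. f \<in> faces T E'} = 2)"
      using mesh unfolding polytopal_mesh_def by (elim conjE)
    from this[rule_format, OF that(1,2)] that(3) show ?thesis by simp
  qed
  define I where "I = {f. \<not> f \<subseteq> frontier \<Omega> \<and> (\<exists>E\<in>elems T. f \<in> faces T E)}"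
  have finI: "finite I"
    by (rule finite_subset[of _ "\<Union>E\<in>elems T. faces T E"]) (use finE finF in \<open>auto simp: I_def\<close>)
  define E0 where "E0 f = (SOME E. E \<in> elems T \<and> f \<in> faces T E)" for f
  have E0: "E0 f \<in> elems T \<and> f \<in> faces T (E0 f)" if "f \<in> I" for f
    using that someI_ex[of "\<lambda>E. E \<in> elems T \<and> f \<in> faces T E"] unfolding E0_def I_def by auto
  define \<sigma> :: "'a set \<Rightarrow> 'a set \<Rightarrow> real" where
    "\<sigma> E f = (if E \<in> elems T \<and> f \<in> faces T E \<and> f \<in> I then if E = E0 f then 1 else - 1 else 0)" for E f
  have \<sigma>_Fh: "(\<lambda>E f. \<sigma> E f * x f) \<in> Fh \<Omega> T" for x
  proof -
    have "\<sigma> E1 f * x f + \<sigma> E2 f * x f = 0"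
      if *: "E1 \<in> elems T" "E2 \<in> elems T" "E1 \<noteq> E2" "f \<in> faces T E1" "f \<in> faces T E2" for E1 E2 f
    proof (cases "f \<in> I")
      case True
      have "card {E'\<in>elems T. f \<in> faces T E'} = 2"
        using two[of E1 f] * True by (auto simp: I_def)
      then obtain A B where AB: "{E'\<in>elems T. f \<in> faces T E'} = {A, B}" "A \<noteq> B"
        by (auto simp: card_2_iff)
      have "E1 \<in> {A, B}" "E2 \<in> {A, B}" "E0 f \<in> {A, B}"
        using AB(1) * E0[OF True] by blast+
      thus ?thesis using * True by (auto simp: \<sigma>_def)
    qed (auto simp: \<sigma>_def)
    moreover have "\<sigma> E f = 0" if "\<not> (E \<in> elems T \<and> f \<in> faces T E)" for E f
      using that by (auto simp: \<sigma>_def)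
    moreover have "\<sigma> E f = 0" if "f \<subseteq> frontier \<Omega>" for E f
      using that by (simp add: \<sigma>_def I_def)
    ultimately show ?thesis
      unfolding Fh_def mem_Collect_eq by (intro conjI allI ballI impI) simp_all
  qed
  have Fh_\<sigma>: "q = (\<lambda>E f. \<sigma> E f * q (E0 f) f)" if q: "q \<in> Fh \<Omega> T" for q
  proof (intro ext)
    fix E f
    show "q E f = \<sigma> E f * q (E0 f) f"
    proof (cases "E \<in> elems T \<and> f \<in> faces T E \<and> f \<in> I \<and> E \<noteq> E0 f")
      case True
      hence "q E f + q (E0 f) f = 0" using that E0[of f] unfolding Fh_def by blast
      thus ?thesis using True by (simp add: \<sigma>_def)
    next
      case False
      show ?thesis
      proof (cases "E \<in> elems T \<and> f \<in> faces T E \<and> f \<in> I")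
        case True
        thus ?thesis using False by (simp add: \<sigma>_def)
      next
        case False
        hence "f \<subseteq> frontier \<Omega>" if "E \<in> elems T" "f \<in> faces T E"
          using that unfolding I_def mem_Collect_eq by metis
        hence "q E f = 0" using q unfolding Fh_def mem_Collect_eq by metis
        moreover have "\<sigma> E f = 0" unfolding \<sigma>_def by (rule if_not_P[OF False])
        ultimately show ?thesis by simp
      qed
    qed
  qed
  define A where "A f g = (\<Sum>E\<in>elems T. \<sigma> E f * M E f g * \<sigma> E g)" for f g
  define b where "b f = (\<Sum>E\<in>elems T. r E f * \<sigma> E f)" for f
  have ext: "(\<Sum>f\<in>faces T E. \<sigma> E f * c f) = (\<Sum>f\<in>I. \<sigma> E f * c f)" if "E \<in> elems T" for E c
    by (rule sum.mono_neutral_cong) (use that finF finI in \<open>auto simp: \<sigma>_def\<close>)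
  have A_eq: "(\<Sum>E\<in>elems T. dot_on (faces T E) (\<lambda>f. \<sigma> E f * x f)
                 (matvec_on (faces T E) (M E) (\<lambda>f. \<sigma> E f * y f))) = dot_on I x (matvec_on I A y)" for x y
  proof -
    have "(\<Sum>E\<in>elems T. dot_on (faces T E) (\<lambda>f. \<sigma> E f * x f)
                 (matvec_on (faces T E) (M E) (\<lambda>f. \<sigma> E f * y f))) =
          (\<Sum>E\<in>elems T. \<Sum>f\<in>faces T E. \<sigma> E f * (x f * (\<Sum>g\<in>faces T E. \<sigma> E g * (M E f g * y g))))"
      by (simp add: dot_on_def matvec_on_def algebra_simps)
    also have "\<dots> = (\<Sum>E\<in>elems T. \<Sum>f\<in>I. \<Sum>g\<in>I. x f * (\<sigma> E f * M E f g * \<sigma> E g * y g))"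
    proof (rule sum.cong[OF refl])
      fix E assume E: "E \<in> elems T"
      show "(\<Sum>f\<in>faces T E. \<sigma> E f * (x f * (\<Sum>g\<in>faces T E. \<sigma> E g * (M E f g * y g)))) =
            (\<Sum>f\<in>I. \<Sum>g\<in>I. x f * (\<sigma> E f * M E f g * \<sigma> E g * y g))"
        unfolding ext[OF E] by (simp add: sum_distrib_left mult_ac)
    qed
    also have "\<dots> = (\<Sum>f\<in>I. \<Sum>g\<in>I. \<Sum>E\<in>elems T. x f * (\<sigma> E f * M E f g * \<sigma> E g * y g))"
      by (subst sum.swap, rule sum.cong[OF refl], rule sum.swap)
    also have "\<dots> = dot_on I x (matvec_on I A y)"
      by (simp add: dot_on_def matvec_on_def A_def sum_distrib_left sum_distrib_right)
    finally show ?thesis .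
  qed
  have A_sym: "\<forall>f\<in>I. \<forall>g\<in>I. A f g = A g f"
  proof (intro ballI)
    fix f g
    have "\<sigma> E f * M E f g * \<sigma> E g = \<sigma> E g * M E g f * \<sigma> E f" if "E \<in> elems T" for E
      using spd[OF that] by (auto simp: \<sigma>_def spd_on_def)
    thus "A f g = A g f" unfolding A_def by (rule sum.cong[OF refl])
  qed
  have A_pos: "0 < dot_on I x (matvec_on I A x)" if x: "\<exists>f\<in>I. x f \<noteq> 0" for x
  proof -
    let ?p = "\<lambda>E f. \<sigma> E f * x f"
    let ?d = "\<lambda>E. dot_on (faces T E) (?p E) (matvec_on (faces T E) (M E) (?p E))"
    from x obtain f where f: "f \<in> I" "x f \<noteq> 0" by auto
    have nn: "0 \<le> ?d E" if "E \<in> elems T" for E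
      by (rule spd_on_nonneg[OF spd[OF that]])
    have "\<exists>g\<in>faces T (E0 f). ?p (E0 f) g \<noteq> 0"
      using E0[OF f(1)] f by (intro bexI[of _ f]) (auto simp: \<sigma>_def)
    hence "0 < ?d (E0 f)"
      by (rule spd_on_pos[OF spd[OF E0[OF f(1), THEN conjunct1]]])
    hence "0 < (\<Sum>E\<in>elems T. ?d E)"
      using E0[OF f(1)] by (intro sum_pos2[OF finE, of "E0 f"]) (auto simp: nn)
    thus ?thesis by (simp add: A_eq)
  qed
  obtain x where x: "\<forall>f\<in>I. matvec_on I A x f = b f"
    using spd_solvable[OF finI A_sym, of b] A_pos by blast
  show ?thesis
  proof (rule bexI[OF _ \<sigma>_Fh[of x]], rule ballI)
    fix q assume q: "q \<in> Fh \<Omega> T"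
    define y where "y f = q (E0 f) f" for f
    have qy: "q E = (\<lambda>f. \<sigma> E f * y f)" for E
      using Fh_\<sigma>[OF q] unfolding y_def by meson
    have "(\<Sum>E\<in>elems T. dot_on (faces T E) (\<lambda>f. \<sigma> E f * x f) (matvec_on (faces T E) (M E) (q E)))
            = dot_on I x (matvec_on I A y)"
      unfolding qy by (rule A_eq)
    also have "\<dots> = dot_on I y (matvec_on I A x)"
    proof -
      have "dot_on I x (matvec_on I A y) = (\<Sum>f\<in>I. \<Sum>g\<in>I. x f * A f g * y g)"
        by (simp add: dot_on_def matvec_on_def sum_distrib_left algebra_simps)
      also have "\<dots> = (\<Sum>g\<in>I. \<Sum>f\<in>I. x f * A f g * y g)" by (rule sum.swap)
      also have "\<dots> = (\<Sum>g\<in>I. \<Sum>f\<in>I. y g * (A g f * x f))"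
        by (intro sum.cong refl) (use A_sym in auto)
      finally show ?thesis by (simp add: dot_on_def matvec_on_def sum_distrib_left)
    qed
    also have "\<dots> = (\<Sum>f\<in>I. y f * b f)" using x by (simp add: dot_on_def)
    also have "\<dots> = (\<Sum>E\<in>elems T. \<Sum>f\<in>I. \<sigma> E f * (r E f * y f))"
      unfolding b_def sum_distrib_left by (subst sum.swap) (simp add: algebra_simps)
    also have "\<dots> = (\<Sum>E\<in>elems T. \<Sum>f\<in>faces T E. \<sigma> E f * (r E f * y f))"
      by (simp add: ext)
    also have "\<dots> = (\<Sum>E\<in>elems T. dot_on (faces T E) (r E) (q E))"
      by (simp add: dot_on_def qy algebra_simps)
    finally show "(\<Sum>E\<in>elems T. dot_on (faces T E) (\<lambda>f. \<sigma> E f * x f) (matvec_on (faces T E) (M E) (q E)))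
       = (\<Sum>E\<in>elems T. dot_on (faces T E) (r E) (q E))" .
  qed
qed

lemma Fh_lincomb:
  assumes p: "p \<in> Fh \<Omega> T" and q: "q \<in> Fh \<Omega> T"
  shows "(\<lambda>E f. a * p E f + b * q E f) \<in> Fh \<Omega> T"
proof -
  note p' = p[unfolded Fh_def mem_Collect_eq] and q' = q[unfolded Fh_def mem_Collect_eq]
  note p1 = p'[THEN conjunct1, rule_format] and q1 = q'[THEN conjunct1, rule_format]
  note p2 = p'[THEN conjunct2, THEN conjunct1, rule_format]
    and q2 = q'[THEN conjunct2, THEN conjunct1, rule_format]
  note p3 = p'[THEN conjunct2, THEN conjunct2, rule_format]
    and q3 = q'[THEN conjunct2, THEN conjunct2, rule_format]
  show ?thesis
    unfolding Fh_def mem_Collect_eq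
  proof (intro conjI allI ballI impI)
    fix E f assume *: "\<not> (E \<in> elems T \<and> f \<in> faces T E)"
    show "a * p E f + b * q E f = 0" using p1[OF *] q1[OF *] by simp
  next
    fix E1 E2 f
    assume *: "E1 \<in> elems T" "E2 \<in> elems T" "E1 \<noteq> E2" "f \<in> faces T E1 \<inter> faces T E2"
    have "a * p E1 f + b * q E1 f + (a * p E2 f + b * q E2 f) =
          a * (p E1 f + p E2 f) + b * (q E1 f + q E2 f)"
      by (simp add: algebra_simps)
    thus "a * p E1 f + b * q E1 f + (a * p E2 f + b * q E2 f) = 0"
      unfolding p2[OF *] q2[OF *] by simp
  next
    fix E f assume *: "E \<in> elems T" "f \<in> faces T E" "f \<subseteq> frontier \<Omega>"
    show "a * p E f + b * q E f = 0" using p3[OF *] q3[OF *] by simp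
  qed
qed

lemma Fh3_lincomb:
  "p \<in> Fh3 \<Omega> T \<Longrightarrow> q \<in> Fh3 \<Omega> T \<Longrightarrow> (\<lambda>E f. a *\<^sub>R p E f + b *\<^sub>R q E f) \<in> Fh3 \<Omega> T"
  by (simp add: Fh3_def Fh_lincomb)

lemma innerF_add_left: "innerF T M (\<lambda>E f. p E f + p' E f) q = innerF T M p q + innerF T M p' q"
  by (simp add: innerF_def dot_on_def distrib_right sum.distrib)

lemma innerF_scale_left: "innerF T M (\<lambda>E f. c *\<^sub>R p E f) q = c * innerF T M p q"
  by (simp add: innerF_def dot_on_def sum_distrib_left mult.assoc)

lemma innerF_eq_0D:
  assumes mesh: "polytopal_mesh \<Omega> T"
    and spd: "\<And>E. E \<in> elems T \<Longrightarrow> spd_on (faces T E) (M E)"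
    and p: "p \<in> Fh3 \<Omega> T" and 0: "innerF T M p p = 0"
  shows "p E f = 0"
proof (rule ccontr)
  assume "p E f \<noteq> 0"
  then obtain u where u: "p E f $ u \<noteq> 0" by (auto simp: vec_eq_iff)
  have "(\<lambda>E f. p E f $ u) \<in> Fh \<Omega> T" using p by (simp add: Fh3_def)
  from this[unfolded Fh_def mem_Collect_eq, THEN conjunct1, rule_format, of E f]
  have Ef: "E \<in> elems T" "f \<in> faces T E" using u by metis+
  let ?d = "\<lambda>u E. dot_on (faces T E) (\<lambda>f. p E f $ u) (matvec_on (faces T E) (M E) (\<lambda>f. p E f $ u))"
  have nn: "0 \<le> ?d u E" if "E \<in> elems T" for u E
    by (rule spd_on_nonneg[OF spd[OF that]])
  have "0 < ?d u E"
    by (rule spd_on_pos[OF spd[OF Ef(1)]], rule bexI[of _ f], rule u, rule Ef(2))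
  hence "0 < (\<Sum>E\<in>elems T. ?d u E)"
    using mesh Ef by (intro sum_pos2[of _ E]) (auto simp: nn polytopal_mesh_def)
  hence "0 < innerF T M p p" unfolding innerF_def
    by (intro sum_pos2[of _ u]) (auto intro!: sum_nonneg nn)
  thus False using 0 by simp
qed

lemma GRAD_ex1:
  fixes T :: "'a::euclidean_space mesh"
  assumes mesh: "polytopal_mesh \<Omega> T" and mim: "mimetic_matrices T M"
  shows "\<exists>!p. p \<in> Fh3 \<Omega> T \<and> (\<forall>q\<in>Fh3 \<Omega> T. innerQ T m (DIV T q) = - innerF T M p q)"
proof (rule ex_ex1I)
  have spd: "spd_on (faces T E) (M E)" if "E \<in> elems T" for E
    using mim that by (auto simp: mimetic_matrices_def)
  define r :: "3 \<Rightarrow> 'a set \<Rightarrow> 'a set \<Rightarrow> real" where "r u E f = - (elem_volume E * (m E $ u) * (1 / elem_volume E) * face_area f)" for u E f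
  have "\<forall>u. \<exists>p. p \<in> Fh \<Omega> T \<and> (\<forall>q\<in>Fh \<Omega> T.
    (\<Sum>E\<in>elems T. dot_on (faces T E) (p E) (matvec_on (faces T E) (M E) (q E))) =
    (\<Sum>E\<in>elems T. dot_on (faces T E) (r u E) (q E)))"
    using riesz_Fh[OF mesh spd] unfolding Bex_def by (rule allI)
  from choice[OF this] obtain P where P0: "\<forall>u. P u \<in> Fh \<Omega> T \<and> (\<forall>q\<in>Fh \<Omega> T.
    (\<Sum>E\<in>elems T. dot_on (faces T E) (P u E) (matvec_on (faces T E) (M E) (q E))) =
    (\<Sum>E\<in>elems T. dot_on (faces T E) (r u E) (q E)))"
    by (rule exE)
  have P: "P u \<in> Fh \<Omega> T" for u
    by (rule P0[THEN spec, THEN conjunct1])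
  have P_eq: "(\<Sum>E\<in>elems T. dot_on (faces T E) (P u E) (matvec_on (faces T E) (M E) (q E))) =
    (\<Sum>E\<in>elems T. dot_on (faces T E) (r u E) (q E))" if "q \<in> Fh \<Omega> T" for u q
    by (rule P0[THEN spec, THEN conjunct2, THEN bspec, OF that])
  define p :: "'a set \<Rightarrow> 'a set \<Rightarrow> real^3" where "p E f = (\<chi> u. P u E f)" for E f
  have "innerQ T m (DIV T q) = - innerF T M p q" if q: "q \<in> Fh3 \<Omega> T" for q
  proof -
    have "innerF T M p q = (\<Sum>u\<in>UNIV. \<Sum>E\<in>elems T. dot_on (faces T E) (r u E) (\<lambda>f. q E f $ u))"
      unfolding innerF_def
    proof (rule sum.cong[OF refl])
      fix u :: 3
      have "(\<lambda>E f. q E f $ u) \<in> Fh \<Omega> T" using q by (simp add: Fh3_def)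
      from P_eq[OF this, of u]
      show "(\<Sum>E\<in>elems T. dot_on (faces T E) (\<lambda>f. p E f $ u)
               (matvec_on (faces T E) (M E) (\<lambda>f. q E f $ u))) =
            (\<Sum>E\<in>elems T. dot_on (faces T E) (r u E) (\<lambda>f. q E f $ u))"
        by (simp add: p_def)
    qed
    also have "\<dots> = - innerQ T m (DIV T q)"
      unfolding innerQ_def sum_negf[symmetric]
    proof (intro sum.cong refl)
      fix u E assume E: "E \<in> elems T"
      have "dot_on (faces T E) (r u E) (\<lambda>f. q E f $ u) =
            (\<Sum>f\<in>faces T E. - (elem_volume E * (m E $ u) * (1 / elem_volume E)) * (face_area f * (q E f $ u)))"
        by (simp add: dot_on_def r_def mult.assoc)
      also have "\<dots> = - (elem_volume E * (m E $ u) * (1 / elem_volume E)) * (\<Sum>f\<in>faces T E. face_area f * (q E f $ u))"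
        by (rule sum_distrib_left[symmetric])
      also have "\<dots> = - (elem_volume E * (m E $ u) * (DIV T q E $ u))"
        using E by (simp add: DIV_def)
      finally show "dot_on (faces T E) (r u E) (\<lambda>f. q E f $ u) = - (elem_volume E * (m E $ u) * (DIV T q E $ u))" .
    qed
    finally show ?thesis by simp
  qed
  moreover have "p \<in> Fh3 \<Omega> T" using P by (simp add: p_def Fh3_def)
  ultimately show "\<exists>p. p \<in> Fh3 \<Omega> T \<and> (\<forall>q\<in>Fh3 \<Omega> T. innerQ T m (DIV T q) = - innerF T M p q)"
    by blast
next
  fix p p'
  assume *: "p \<in> Fh3 \<Omega> T \<and> (\<forall>q\<in>Fh3 \<Omega> T. innerQ T m (DIV T q) = - innerF T M p q)"
    "p' \<in> Fh3 \<Omega> T \<and> (\<forall>q\<in>Fh3 \<Omega> T. innerQ T m (DIV T q) = - innerF T M p' q)"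
  let ?d = "\<lambda>E f. 1 *\<^sub>R p E f + (- 1) *\<^sub>R p' E f"
  have d: "?d \<in> Fh3 \<Omega> T"
    by (rule Fh3_lincomb) (use * in auto)
  have "innerF T M ?d ?d = innerF T M p ?d - innerF T M p' ?d"
    unfolding innerF_add_left innerF_scale_left by simp
  also have "\<dots> = 0"
    using *[THEN conjunct2, THEN bspec, OF d] by linarith
  finally have "innerF T M ?d ?d = 0" .
  moreover have "spd_on (faces T E) (M E)" if "E \<in> elems T" for E
    using mim that by (simp add: mimetic_matrices_def)
  ultimately have "?d E f = 0" for E f
    using innerF_eq_0D[OF mesh _ d] by blast
  thus "p = p'" by (intro ext) auto
qed

lemma GRAD_works:
  assumes "polytopal_mesh \<Omega> T" "mimetic_matrices T M"
  shows "GRAD \<Omega> T M m \<in> Fh3 \<Omega> T \<and>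
    (\<forall>q\<in>Fh3 \<Omega> T. innerQ T m (DIV T q) = - innerF T M (GRAD \<Omega> T M m) q)"
  unfolding GRAD_def by (rule theI'[OF GRAD_ex1[OF assms]])

lemmas GRAD_in = GRAD_works[THEN conjunct1]
  and GRAD_adjoint = GRAD_works[THEN conjunct2, THEN bspec]

lemma GRAD_linear:
  assumes "polytopal_mesh \<Omega> T" "mimetic_matrices T M"
  shows "GRAD \<Omega> T M (\<lambda>E. a *\<^sub>R m E + b *\<^sub>R w E) =
    (\<lambda>E f. a *\<^sub>R GRAD \<Omega> T M m E f + b *\<^sub>R GRAD \<Omega> T M w E f)" (is "_ = ?p")
proof -
  let ?P = "\<lambda>p. p \<in> Fh3 \<Omega> T \<and> (\<forall>q\<in>Fh3 \<Omega> T.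
       innerQ T (\<lambda>E. a *\<^sub>R m E + b *\<^sub>R w E) (DIV T q) = - innerF T M p q)"
  have "?p \<in> Fh3 \<Omega> T"
    by (rule Fh3_lincomb[OF GRAD_in[OF assms] GRAD_in[OF assms]])
  moreover have "innerQ T (\<lambda>E. a *\<^sub>R m E + b *\<^sub>R w E) v = a * innerQ T m v + b * innerQ T w v" for v
  proof -
    have "elem_volume E * ((a *\<^sub>R m E + b *\<^sub>R w E) $ u) * (v E $ u) =
            a * (elem_volume E * (m E $ u) * (v E $ u)) + b * (elem_volume E * (w E $ u) * (v E $ u))" for u E
      by (simp add: algebra_simps)
    thus ?thesis unfolding innerQ_def by (simp only: sum.distrib sum_distrib_left)
  qed
  ultimately have 1: "?P ?p"
    unfolding innerF_add_left innerF_scale_left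
    using GRAD_adjoint[OF assms, of _ m] GRAD_adjoint[OF assms, of _ w] by simp
  show ?thesis
    by (rule trans[OF GRAD_def], rule the1_equality[OF GRAD_ex1[OF assms]], rule 1)
qed


section \<open>The time-stepping scheme\<close>

definition theta_step ::
    "'a::euclidean_space set \<Rightarrow> 'a mesh \<Rightarrow> ('a set \<Rightarrow> 'a set \<Rightarrow> 'a set \<Rightarrow> real) \<Rightarrow>
     real \<Rightarrow> real \<Rightarrow> real \<Rightarrow>
     ('a set \<Rightarrow> real^3) \<Rightarrow> ('a set \<Rightarrow> real^3) \<Rightarrow> ('a set \<Rightarrow> real^3) \<Rightarrow> bool" where
  "theta_step \<Omega> T M \<alpha> \<theta> k m mhat m' \<longleftrightarrow>
     mhat \<in> Qh3 T \<and> m' \<in> Qh3 T \<and>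
     (let p = (\<lambda>E f. - GRAD \<Omega> T M (\<lambda>E. m E + \<theta> *\<^sub>R (mhat E - m E)) E f) in
       \<forall>E\<in>elems T.
         (1 / k) *\<^sub>R (mhat E - m E) + \<alpha> *\<^sub>R DIV T p E =
           cross3 (m E) (DIV T p E) + (\<alpha> * (m E \<bullet> DIV T p E)) *\<^sub>R m E) \<and>
     (\<forall>E\<in>elems T. m' E = (1 / norm (mhat E)) *\<^sub>R mhat E)"

end

theory Submission
  imports Defs
begin

text \<open>
  Write \<open>a v w\<close> for the inner product of \<open>GRAD v\<close> and \<open>GRAD w\<close>; the claim is that the energy \<open>a v v\<close>
  does not grow in either half of a time step.

  \<^emph>\<open>The linear half step.\<close> Put \<open>v = (mhat - m) / k\<close>. In every element the equation makes \<open>v\<close>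
  orthogonal to \<open>m\<close>, so \<open>\<bar>mhat\<bar> \<ge> 1\<close>, and testing it with the discrete divergence gives
  \<open>(1 + \<alpha>\<^sup>2) a v w = - \<alpha> \<parallel>v\<parallel>\<^sup>2\<close> for the state \<open>w\<close> at which the flux is taken (\<open>dissipation\<close>). The
  energy of \<open>mhat = m + k v\<close> is a quadratic polynomial in \<open>k\<close>. For \<open>w = mhat\<close> it is convexity that
  makes it decrease; for \<open>w = m\<close> the second order term \<open>k\<^sup>2 a v v\<close> has the wrong sign, and the inverse
  estimate and the Courant condition bound it by the dissipation (\<open>theta_step_energy\<close>).

  \<^emph>\<open>Renormalisation.\<close> Where \<open>\<bar>x\<bar> \<ge> 1\<close>, the map \<open>x \<mapsto> x / \<bar>x\<bar>\<close> is the closest point projection onto the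
  unit ball, which is 1-Lipschitz on the whole space. It thus suffices that \<open>a v v\<close> decreases when
  any 1-Lipschitz map \<open>\<phi>\<close> is applied to all values of \<open>v\<close> (\<open>energy_contract\<close>), a discrete form of the
  Beurling-Deny contraction property. The matrix of \<open>a\<close> contains the inverse of an assembled
  matrix, so its signs are not visible. Hybridisation avoids it: with additional values \<open>\<mu>\<close> on the
  faces, \<open>a v v\<close> is the minimum over \<open>\<mu>\<close> of a sum of local forms with the matrices \<open>C W C\<close>, where
  \<open>W\<close> is the inverse of the local flux matrix and \<open>C\<close> the diagonal matrix of face areas
  (\<open>energy_le_hybrid\<close>, \<open>energy_eq_hybrid\<close>). The two
  assumptions on \<open>W\<close> and the positivity of face areas make such a form a sum,
  with nonnegative weights, of squared
  differences of element and face values (\<open>vec_form_graph\<close>), so that it decreases when \<open>\<phi>\<close> is applied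
  to \<open>v\<close> and to the minimising \<open>\<mu>\<close> alike. The new face values need not be optimal, which only
  helps: the minimum is even smaller.
\<close>

section \<open>Positive measure of polytopal cells\<close>

lemma measure_lborel_pos_if_open_subset:
  fixes S U :: "'a::euclidean_space set"
  assumes "compact S" "open U" "U \<noteq> {}" "U \<subseteq> S"
  shows "0 < measure lborel S"
proof -
  have "\<not> negligible S"
    using open_not_negligible[OF assms(2,3)] assms(4) negligible_subset by blast
  hence "measure lebesgue S \<noteq> 0"
    using negligible_iff_measure0[OF lmeasurable_compact[OF assms(1)]] by simp
  hence "measure lborel S \<noteq> 0"
    using assms(1) by (simp add: measure_completion borel_compact)
  thus ?thesis by (simp add: zero_less_measure_iff)
qed

lemma polytopal_cell_compact: "polytopal_cell k S \<Longrightarrow> compact S"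
  by (auto simp: polytopal_cell_def intro: compact_Union compact_simplex)

lemma polytopal_cell_subsimplex:
  assumes "polytopal_cell k S"
  obtains \<sigma> where "k simplex \<sigma>" "\<sigma> \<subseteq> S"
  using assms unfolding polytopal_cell_def by (metis Union_upper ex_in_conv)

lemma elem_volume_pos:
  fixes E :: "'a::euclidean_space set"
  assumes "polytopal_cell (int DIM('a)) E"
  shows "0 < elem_volume E"
proof -
  obtain \<sigma> where \<sigma>: "int DIM('a) simplex \<sigma>" "\<sigma> \<subseteq> E"
    using polytopal_cell_subsimplex[OF assms] .
  have "interior \<sigma> = rel_interior \<sigma>"
    by (rule interior_rel_interior[symmetric, OF aff_dim_simplex[OF \<sigma>(1)]])
  moreover have "\<sigma> \<noteq> {}" using \<sigma>(1) by auto
  ultimately have "interior \<sigma> \<noteq> {}"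
    using rel_interior_eq_empty[OF convex_simplex[OF \<sigma>(1)]] by simp
  thus ?thesis unfolding elem_volume_def
    using \<sigma>(2) interior_subset[of \<sigma>]
    by (intro measure_lborel_pos_if_open_subset[OF polytopal_cell_compact[OF assms] open_interior, of \<sigma>]) auto
qed

text \<open>The area of a face is by definition the volume of a prism of height 1 over it. A simplex in the
  face has a relative interior that is open in the hyperplane, so the open prism over it is a
  nonempty open set inside the compact prism over the face.\<close>

lemma face_area_pos:
  fixes f :: "'a::euclidean_space set"
  assumes f: "polytopal_cell (int DIM('a) - 1) f"
  shows "0 < face_area f"
proof -
  define Q where "Q = (\<lambda>(n::'a, b). norm n = 1 \<and> (\<forall>x\<in>f. n \<bullet> x = b))"
  have "\<exists>z. Q z"
  proof -
    have "aff_dim f = int DIM('a) - 1" using f by (simp add: polytopal_cell_def)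
    then obtain a b where a: "a \<noteq> 0" and *: "affine hull f = {x. a \<bullet> x = b}"
      using aff_dim_eq_hyperplane[of f] by (auto simp: of_nat_diff)
    have "f \<subseteq> {x. a \<bullet> x = b}" using hull_subset[of f affine] * by auto
    hence "Q (a /\<^sub>R norm a, b / norm a)"
      using a by (auto simp: Q_def divide_inverse_commute)
    thus ?thesis by blast
  qed
  hence "Q (SOME z. Q z)" by (rule someI_ex)
  moreover obtain n b where nb: "(SOME z. Q z) = (n, b)" by fastforce
  ultimately have n1: "norm n = 1" and nf: "\<And>x. x \<in> f \<Longrightarrow> n \<bullet> x = b" by (auto simp: Q_def)
  have nn: "n \<bullet> n = 1" using n1 by (simp add: dot_square_norm)
  have fm: "face_measure f = hyperplane_measure n b"
    using nb by (simp add: face_measure_def Q_def)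
  define \<pi> where "\<pi> x = x - (n \<bullet> x - b) *\<^sub>R n" for x
  have \<pi>_cont: "continuous_on UNIV \<pi>" unfolding \<pi>_def by (intro continuous_intros)
  have \<pi>_plane: "n \<bullet> \<pi> x = b" for x by (simp add: \<pi>_def inner_diff_right nn)
  define slab where "slab = {x. b \<le> n \<bullet> x \<and> n \<bullet> x \<le> b + 1}"
  have slab: "closed slab" unfolding slab_def
    by (intro closed_Collect_conj closed_Collect_le continuous_intros)
  have cf: "compact f" by (rule polytopal_cell_compact[OF f])
  define P where "P = \<pi> -` f \<inter> slab"
  have "closed (\<pi> -` f)"
    by (rule closed_vimage[OF compact_imp_closed[OF cf] \<pi>_cont])
  hence "closed P" unfolding P_def by (rule closed_Int[OF _ slab])
  moreover have "bounded P"
  proof -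
    obtain B where B: "\<And>x. x \<in> f \<Longrightarrow> norm x \<le> B"
      using compact_imp_bounded[OF cf] by (auto simp: bounded_iff)
    have "norm x \<le> B + 1" if "x \<in> P" for x
    proof -
      have "norm x \<le> norm (\<pi> x) + norm ((n \<bullet> x - b) *\<^sub>R n)"
        using norm_triangle_ineq[of "\<pi> x" "(n \<bullet> x - b) *\<^sub>R n"] by (simp add: \<pi>_def)
      thus ?thesis using that B[of "\<pi> x"] n1 by (auto simp: P_def slab_def)
    qed
    thus ?thesis by (auto simp: bounded_iff)
  qed
  ultimately have cP: "compact P" by (simp add: compact_eq_bounded_closed)
  have "\<pi> \<in> borel_measurable (restrict_space lborel slab)"
    using borel_measurable_continuous_onI[OF \<pi>_cont]
    by (intro measurable_restrict_space1) simp
  hence "face_area f = measure (restrict_space lborel slab) (\<pi> -` f \<inter> space (restrict_space lborel slab))"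
    unfolding face_area_def fm hyperplane_measure_def slab_def[symmetric] \<pi>_def[abs_def, symmetric]
    by (rule measure_distr) (simp add: borel_compact[OF cf])
  also have "\<dots> = measure lborel P"
    by (subst measure_restrict_space) (auto simp: P_def space_restrict_space borel_closed[OF slab])
  finally have area: "face_area f = measure lborel P" .
  obtain \<sigma> where \<sigma>: "(int DIM('a) - 1) simplex \<sigma>" "\<sigma> \<subseteq> f"
    using polytopal_cell_subsimplex[OF f] .
  have \<sigma>_ne: "\<sigma> \<noteq> {}" using \<sigma>(1) by auto
  have hull: "affine hull \<sigma> = {x. n \<bullet> x = b}"
  proof (rule affine_dim_equal)
    show "affine hull \<sigma> \<subseteq> {x. n \<bullet> x = b}"
      using \<sigma>(2) nf by (intro hull_minimal affine_hyperplane) auto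
    show "aff_dim (affine hull \<sigma>) = aff_dim {x. n \<bullet> x = b}"
      using n1 aff_dim_simplex[OF \<sigma>(1)] by (subst aff_dim_hyperplane) auto
  qed (use \<sigma>_ne in \<open>auto simp: affine_hyperplane\<close>)
  obtain x0 where x0: "x0 \<in> rel_interior \<sigma>"
    using rel_interior_eq_empty[OF convex_simplex[OF \<sigma>(1)]] \<sigma>_ne by auto
  then obtain U where U: "open U" "x0 \<in> U" "U \<inter> affine hull \<sigma> \<subseteq> \<sigma>"
    unfolding mem_rel_interior by blast
  have x0b: "n \<bullet> x0 = b" using x0 rel_interior_subset[of \<sigma>] \<sigma>(2) nf by blast
  let ?V = "\<pi> -` U \<inter> {x. b < n \<bullet> x \<and> n \<bullet> x < b + 1}"
  have "open ?V"
    by (intro open_Int open_vimage[OF U(1) \<pi>_cont] open_Collect_conj open_Collect_less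
          continuous_intros)
  moreover have "x0 + (1/2) *\<^sub>R n \<in> ?V"
    using U(2) by (simp add: \<pi>_def inner_add_right nn x0b)
  moreover have "?V \<subseteq> P"
    using U(3) \<pi>_plane \<sigma>(2) by (auto simp: P_def slab_def hull)
  ultimately show ?thesis
    unfolding area by (intro measure_lborel_pos_if_open_subset[OF cP, of ?V]) auto
qed

section \<open>Symmetric positive definite matrices and forms of vectors\<close>

text \<open>The components of a flux enter the energy independently. A form of vectors keeps them
  together, as the Lipschitz map of the contraction argument mixes them.\<close>

definition vec_form :: "'f set \<Rightarrow> ('f \<Rightarrow> 'f \<Rightarrow> real) \<Rightarrow> ('f \<Rightarrow> 'v::euclidean_space) \<Rightarrow> ('f \<Rightarrow> 'v) \<Rightarrow> real"
  where "vec_form I A p q = (\<Sum>f\<in>I. \<Sum>g\<in>I. A f g * (p f \<bullet> q g))"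

lemma vec_form_components:
  fixes p q :: "'f \<Rightarrow> real^'n"
  shows "vec_form I A p q = (\<Sum>u\<in>UNIV. dot_on I (\<lambda>f. p f $ u) (matvec_on I A (\<lambda>f. q f $ u)))"
proof -
  have "vec_form I A p q = (\<Sum>f\<in>I. \<Sum>g\<in>I. \<Sum>u\<in>UNIV. (p f $ u) * (A f g * (q g $ u)))"
    by (simp add: vec_form_def inner_vec_def sum_distrib_left mult_ac)
  also have "\<dots> = (\<Sum>f\<in>I. \<Sum>u\<in>UNIV. \<Sum>g\<in>I. (p f $ u) * (A f g * (q g $ u)))"
    by (rule sum.cong[OF refl], rule sum.swap)
  also have "\<dots> = (\<Sum>u\<in>UNIV. \<Sum>f\<in>I. \<Sum>g\<in>I. (p f $ u) * (A f g * (q g $ u)))"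
    by (rule sum.swap)
  finally show ?thesis by (simp add: dot_on_def matvec_on_def sum_distrib_left)
qed

lemma vec_form_diff:
  assumes "\<forall>f\<in>I. \<forall>g\<in>I. A f g = A g f"
  shows "vec_form I A (\<lambda>f. p f - q f) (\<lambda>f. p f - q f)
           = vec_form I A p p - 2 * vec_form I A p q + vec_form I A q q"
proof -
  have "vec_form I A q p = (\<Sum>g\<in>I. \<Sum>f\<in>I. A f g * (q f \<bullet> p g))"
    unfolding vec_form_def by (rule sum.swap)
  also have "\<dots> = vec_form I A p q"
    unfolding vec_form_def
    by (intro sum.cong refl) (use assms in \<open>auto simp: inner_commute\<close>)
  finally have "vec_form I A q p = vec_form I A p q" .
  moreover have "vec_form I A (\<lambda>f. p f - q f) (\<lambda>f. p f - q f)
           = vec_form I A p p - vec_form I A p q - vec_form I A q p + vec_form I A q q"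
    by (simp add: vec_form_def inner_diff_left inner_diff_right algebra_simps sum.distrib sum_subtractf)
  ultimately show ?thesis by simp
qed

lemma vec_form_nonneg:
  fixes p :: "'f \<Rightarrow> real^'n"
  shows "spd_on I A \<Longrightarrow> 0 \<le> vec_form I A p p"
  unfolding vec_form_components by (intro sum_nonneg spd_on_nonneg)

lemma vec_form_left:
  "vec_form I A p q = (\<Sum>g\<in>I. (\<Sum>f\<in>I. A f g *\<^sub>R p f) \<bullet> q g)"
  unfolding vec_form_def by (subst sum.swap) (simp add: inner_sum_left)

lemma vec_form_right:
  "vec_form I A p q = (\<Sum>f\<in>I. p f \<bullet> (\<Sum>g\<in>I. A f g *\<^sub>R q g))"
  unfolding vec_form_def by (simp add: inner_sum_right)

text \<open>The columns of an inverse solve linear systems with right-hand sides the unit vectors. This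
  gives a right inverse only; its transpose is a left inverse by the symmetry of \<open>A\<close>, so the two
  agree.\<close>

lemma spd_inverse:
  assumes I: "finite I" and A: "spd_on I A"
  shows "inverses_on I A (inverse_on I A)"
    and "\<forall>f\<in>I. \<forall>g\<in>I. inverse_on I A f g = inverse_on I A g f"
proof -
  have sym: "\<forall>f\<in>I. \<forall>g\<in>I. A f g = A g f" using A by (simp add: spd_on_def)
  have "\<forall>g. \<exists>x. \<forall>f\<in>I. matvec_on I A x f = (if f = g then 1 else 0)"
    using A by (intro allI spd_solvable[OF I sym]) (simp add: spd_on_def)
  then obtain X where X: "\<forall>g. \<forall>f\<in>I. matvec_on I A (X g) f = (if f = g then 1 else 0)"
    by metis
  define B where "B f g = X g f" for f g
  have AB: "(\<Sum>l\<in>I. A f l * B l g) = (if f = g then 1 else 0)" if "f \<in> I" for f g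
    using X that by (simp add: matvec_on_def B_def)
  have BA: "(\<Sum>l\<in>I. B l f * A l g) = (if f = g then 1 else 0)" if "g \<in> I" for f g
    using AB[OF that, of f] sym that by (simp add: mult.commute eq_commute[of g f] cong: sum.cong)
  have BT: "B g f = B f g" if "f \<in> I" "g \<in> I" for f g
  proof -
    have "B f g = (\<Sum>j\<in>I. (if f = j then 1 else 0) * B j g)"
      using I that by (simp add: if_distrib[of "\<lambda>c. c * _"] cong: if_cong)
    also have "\<dots> = (\<Sum>j\<in>I. (\<Sum>l\<in>I. B l f * A l j) * B j g)"
      by (intro sum.cong refl) (simp add: BA)
    also have "\<dots> = (\<Sum>l\<in>I. B l f * (\<Sum>j\<in>I. A l j * B j g))"
      unfolding sum_distrib_left sum_distrib_right by (subst sum.swap) (simp add: mult.assoc)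
    also have "\<dots> = (\<Sum>l\<in>I. B l f * (if l = g then 1 else 0))"
      by (intro sum.cong refl) (simp add: AB)
    also have "\<dots> = B g f" using I that by (simp add: if_distrib cong: if_cong)
    finally show ?thesis by simp
  qed
  have "(\<Sum>l\<in>I. B f l * A l g) = (if f = g then 1 else 0)" if "f \<in> I" "g \<in> I" for f g
    using BA[OF that(2), of f] BT[OF that(1)] by (simp cong: sum.cong)
  hence "inverses_on I A B"
    unfolding inverses_on_def using AB by blast
  thus inv: "inverses_on I A (inverse_on I A)"
    unfolding inverse_on_def by (rule someI[of "inverses_on I A"])
  let ?W = "inverse_on I A"
  have "?W f g = B f g" if "f \<in> I" "g \<in> I" for f g
  proof -
    have "?W f g = (\<Sum>j\<in>I. ?W f j * (if j = g then 1 else 0))"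
      using I that by (simp add: if_distrib cong: if_cong)
    also have "\<dots> = (\<Sum>j\<in>I. ?W f j * (\<Sum>l\<in>I. A j l * B l g))"
      by (intro sum.cong refl) (simp add: AB)
    also have "\<dots> = (\<Sum>l\<in>I. (\<Sum>j\<in>I. ?W f j * A j l) * B l g)"
      unfolding sum_distrib_left sum_distrib_right by (subst sum.swap) (simp add: mult.assoc)
    also have "\<dots> = (\<Sum>l\<in>I. (if f = l then 1 else 0) * B l g)"
      using inv that by (intro sum.cong refl) (auto simp: inverses_on_def)
    also have "\<dots> = B f g"
      using I that by (simp add: if_distrib[of "\<lambda>c. c * _"] cong: if_cong)
    finally show ?thesis .
  qed
  thus "\<forall>f\<in>I. \<forall>g\<in>I. ?W f g = ?W g f" using BT by simp
qed

lemma spd_inverse_solves: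
  fixes y :: "'f \<Rightarrow> 'v::euclidean_space"
  assumes I: "finite I" and A: "spd_on I A" and f: "f \<in> I"
  shows "(\<Sum>g\<in>I. A f g *\<^sub>R (\<Sum>l\<in>I. inverse_on I A g l *\<^sub>R y l)) = y f"
    and "(\<Sum>g\<in>I. inverse_on I A f g *\<^sub>R (\<Sum>l\<in>I. A g l *\<^sub>R y l)) = y f"
proof -
  have compose: "(\<Sum>g\<in>I. P f g *\<^sub>R (\<Sum>l\<in>I. Q g l *\<^sub>R y l)) = y f"
    if "\<And>l. l \<in> I \<Longrightarrow> (\<Sum>g\<in>I. P f g * Q g l) = (if f = l then 1 else 0)" for P Q
  proof -
    have "(\<Sum>g\<in>I. P f g *\<^sub>R (\<Sum>l\<in>I. Q g l *\<^sub>R y l)) = (\<Sum>l\<in>I. (\<Sum>g\<in>I. P f g * Q g l) *\<^sub>R y l)"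
      unfolding scaleR_sum_right scaleR_sum_left by (subst sum.swap) simp
    also have "\<dots> = (\<Sum>l\<in>I. (if f = l then 1 else 0) *\<^sub>R y l)"
      by (intro sum.cong refl) (simp add: that)
    also have "\<dots> = y f" using I f by (simp add: if_distrib[of "\<lambda>c. c *\<^sub>R _"] cong: if_cong)
    finally show ?thesis .
  qed
  show "(\<Sum>g\<in>I. A f g *\<^sub>R (\<Sum>l\<in>I. inverse_on I A g l *\<^sub>R y l)) = y f"
    and "(\<Sum>g\<in>I. inverse_on I A f g *\<^sub>R (\<Sum>l\<in>I. A g l *\<^sub>R y l)) = y f"
    using spd_inverse(1)[OF I A] f by (auto intro!: compose simp: inverses_on_def)
qed

text \<open>The Fenchel-Young inequality for the quadratic form of \<open>A\<close>: the convex conjugate is the form of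
  the inverse matrix. The gap between the two sides is the form at \<open>A\<^sup>-\<^sup>1 y - p\<close>.\<close>

lemma spd_Young:
  fixes y p :: "'f \<Rightarrow> real^'n"
  assumes I: "finite I" and A: "spd_on I A"
  shows "2 * (\<Sum>f\<in>I. y f \<bullet> p f) \<le> vec_form I (inverse_on I A) y y + vec_form I A p p"
proof -
  define s where "s f = (\<Sum>g\<in>I. inverse_on I A f g *\<^sub>R y g)" for f
  have sym: "\<forall>f\<in>I. \<forall>g\<in>I. A f g = A g f" using A by (simp add: spd_on_def)
  have As: "(\<Sum>f\<in>I. A f g *\<^sub>R s f) = y g" if "g \<in> I" for g
  proof -
    have "(\<Sum>f\<in>I. A f g *\<^sub>R s f) = (\<Sum>f\<in>I. A g f *\<^sub>R s f)"
      using sym that by (intro sum.cong) auto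
    also have "\<dots> = y g" unfolding s_def by (rule spd_inverse_solves(1)[OF I A that])
    finally show ?thesis .
  qed
  have "vec_form I A s p = (\<Sum>f\<in>I. y f \<bullet> p f)"
    unfolding vec_form_left by (simp add: As)
  moreover have "vec_form I A s s = vec_form I (inverse_on I A) y y"
    unfolding vec_form_left[of I A] vec_form_right[of I "inverse_on I A"] by (simp add: As flip: s_def)
  ultimately show ?thesis
    using vec_form_nonneg[OF A, of "\<lambda>f. s f - p f"] unfolding vec_form_diff[OF sym] by simp
qed

lemma spd_Young_eq:
  fixes p :: "'f \<Rightarrow> real^'n"
  assumes I: "finite I" and A: "spd_on I A"
    and y: "\<And>f. f \<in> I \<Longrightarrow> y f = (\<Sum>g\<in>I. A f g *\<^sub>R p g)"
  shows "vec_form I (inverse_on I A) y y = vec_form I A p p"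
proof -
  have "(\<Sum>g\<in>I. inverse_on I A f g *\<^sub>R y g) = p f" if "f \<in> I" for f
    using spd_inverse_solves(2)[OF I A that, of p] by (simp add: y cong: sum.cong)
  hence "vec_form I (inverse_on I A) y y = (\<Sum>f\<in>I. y f \<bullet> p f)"
    unfolding vec_form_right by simp
  also have "\<dots> = vec_form I A p p"
    unfolding vec_form_right by (simp add: y inner_commute)
  finally show ?thesis .
qed

text \<open>Polarisation \<open>2 x \<bullet> y = \<bar>x\<bar>\<^sup>2 + \<bar>y\<bar>\<^sup>2 - \<bar>x - y\<bar>\<^sup>2\<close> exhibits a symmetric form as the energy of a
  weighted graph: the weights of the edges are the negated off-diagonal entries, and the row sums
  are the weights of edges to a ground vertex of value \<open>0\<close>.\<close>

lemma vec_form_graph: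
  assumes sym: "\<forall>f\<in>I. \<forall>g\<in>I. c f g = c g f"
  shows "vec_form I c x x = (\<Sum>f\<in>I. (\<Sum>g\<in>I. c f g) * (norm (x f))\<^sup>2)
           + (\<Sum>f\<in>I. \<Sum>g\<in>I. - c f g * (norm (x f - x g))\<^sup>2) / 2"
proof -
  have polar: "- c f g * (norm (x f - x g))\<^sup>2 = 2 * (c f g * (x f \<bullet> x g)) - c f g * (norm (x f))\<^sup>2 - c f g * (norm (x g))\<^sup>2" for f g
    by (simp add: power2_norm_eq_inner inner_diff_left inner_diff_right inner_commute algebra_simps)
  have "(\<Sum>f\<in>I. \<Sum>g\<in>I. c f g * (norm (x g))\<^sup>2) = (\<Sum>g\<in>I. \<Sum>f\<in>I. c f g * (norm (x g))\<^sup>2)"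
    by (rule sum.swap)
  also have "\<dots> = (\<Sum>g\<in>I. (\<Sum>f\<in>I. c g f) * (norm (x g))\<^sup>2)"
    unfolding sum_distrib_right by (intro sum.cong refl) (use sym in auto)
  finally have "(\<Sum>f\<in>I. \<Sum>g\<in>I. c f g * (norm (x g))\<^sup>2) = (\<Sum>g\<in>I. (\<Sum>f\<in>I. c g f) * (norm (x g))\<^sup>2)" .
  thus ?thesis
    unfolding polar sum_subtractf sum_distrib_left[symmetric] vec_form_def
    by (simp add: sum_distrib_right add_divide_distrib diff_divide_distrib)
qed

lemma vec_form_contract:
  fixes x :: "'f \<Rightarrow> 'v::euclidean_space" and y :: "'f \<Rightarrow> 'v"
  assumes sym: "\<forall>f\<in>I. \<forall>g\<in>I. c f g = c g f"
    and offdiag: "\<And>f g. f \<in> I \<Longrightarrow> g \<in> I \<Longrightarrow> f \<noteq> g \<Longrightarrow> c f g \<le> 0"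
    and rows: "\<And>f. f \<in> I \<Longrightarrow> 0 \<le> (\<Sum>g\<in>I. c f g)"
    and le: "\<And>f. f \<in> I \<Longrightarrow> norm (y f) \<le> norm (x f)"
    and le_diff: "\<And>f g. f \<in> I \<Longrightarrow> g \<in> I \<Longrightarrow> norm (y f - y g) \<le> norm (x f - x g)"
  shows "vec_form I c y y \<le> vec_form I c x x"
proof -
  have "(\<Sum>f\<in>I. (\<Sum>g\<in>I. c f g) * (norm (y f))\<^sup>2) \<le> (\<Sum>f\<in>I. (\<Sum>g\<in>I. c f g) * (norm (x f))\<^sup>2)"
    by (intro sum_mono mult_left_mono power_mono rows le) auto
  moreover have "- c f g * (norm (y f - y g))\<^sup>2 \<le> - c f g * (norm (x f - x g))\<^sup>2"
    if "f \<in> I" "g \<in> I" for f g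
  proof (cases "f = g")
    case False
    thus ?thesis using offdiag[OF that] le_diff[OF that]
      by (intro mult_left_mono power_mono) auto
  qed simp
  hence "(\<Sum>f\<in>I. \<Sum>g\<in>I. - c f g * (norm (y f - y g))\<^sup>2) \<le> (\<Sum>f\<in>I. \<Sum>g\<in>I. - c f g * (norm (x f - x g))\<^sup>2)"
    by (intro sum_mono)
  ultimately show ?thesis unfolding vec_form_graph[OF sym] by simp
qed

section \<open>The energy as a minimum over face values\<close>

text \<open>Face values are indexed by pairs of an element and a face, since both sides of a boundary face
  are allowed different values: \<open>\<Omega>\<close> may lie on both sides of a part of its boundary, as for a slit.
  Elsewhere the two sides must agree. Such values are the Lagrange multipliers for the
  constraints in the definition of the flux space.\<close>

definition face_trace :: "'a::euclidean_space set \<Rightarrow> 'a mesh \<Rightarrow> ('a set \<Rightarrow> 'a set \<Rightarrow> 'v) \<Rightarrow> bool" where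
  "face_trace \<Omega> T \<mu> \<longleftrightarrow> (\<forall>E1\<in>elems T. \<forall>E2\<in>elems T. \<forall>f\<in>faces T E1 \<inter> faces T E2.
     \<not> f \<subseteq> frontier \<Omega> \<longrightarrow> \<mu> E1 f = \<mu> E2 f)"

text \<open>The energy of the hybridised method, that is, before the elimination of the face values
  \<open>\<mu>\<close>.\<close>

definition hybrid_energy ::
    "'a::euclidean_space mesh \<Rightarrow> ('a set \<Rightarrow> 'a set \<Rightarrow> 'a set \<Rightarrow> real) \<Rightarrow>
     ('a set \<Rightarrow> real^3) \<Rightarrow> ('a set \<Rightarrow> 'a set \<Rightarrow> real^3) \<Rightarrow> real" where
  "hybrid_energy T M v \<mu> = (\<Sum>E\<in>elems T.
     vec_form (faces T E) (inverse_on (faces T E) (M E))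
       (\<lambda>f. face_area f *\<^sub>R (\<mu> E f - v E)) (\<lambda>f. face_area f *\<^sub>R (\<mu> E f - v E)))"

lemma innerF_vec_form: "innerF T M p q = (\<Sum>E\<in>elems T. vec_form (faces T E) (M E) (p E) (q E))"
  unfolding innerF_def vec_form_components by (rule sum.swap)

lemma innerQ_inner: "innerQ T v w = (\<Sum>E\<in>elems T. elem_volume E * (v E \<bullet> w E))"
  unfolding innerQ_def by (subst sum.swap) (simp add: inner_vec_def sum_distrib_left mult.assoc)

locale mimetic_mesh =
  fixes \<Omega> :: "'a::euclidean_space set" and T :: "'a mesh"
    and M :: "'a set \<Rightarrow> 'a set \<Rightarrow> 'a set \<Rightarrow> real"
  assumes mesh: "polytopal_mesh \<Omega> T" and mimetic: "mimetic_matrices T M"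
begin

lemma finite_elems: "finite (elems T)"
  and finite_faces: "E \<in> elems T \<Longrightarrow> finite (faces T E)"
  and volume_pos: "E \<in> elems T \<Longrightarrow> 0 < elem_volume E"
  and area_pos: "E \<in> elems T \<Longrightarrow> f \<in> faces T E \<Longrightarrow> 0 < face_area f"
  and local_spd: "E \<in> elems T \<Longrightarrow> spd_on (faces T E) (M E)"
proof -
  have cells: "\<forall>E\<in>elems T. polytopal_cell (int DIM('a)) E \<and> interior E \<subseteq> \<Omega>"
    using mesh unfolding polytopal_mesh_def by (elim conjE)
  have local_faces: "\<forall>E\<in>elems T. finite (faces T E) \<and> \<Union>(faces T E) = frontier E \<and>
        (\<forall>f\<in>faces T E. polytopal_cell (int DIM('a) - 1) f \<and> (\<exists>!n. outward_unit_normal E f n))"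
    using mesh unfolding polytopal_mesh_def by (elim conjE)
  show "finite (elems T)" using mesh unfolding polytopal_mesh_def by (elim conjE)
  show "finite (faces T E)" if "E \<in> elems T" using local_faces that by simp
  show "0 < elem_volume E" if "E \<in> elems T" using cells that by (simp add: elem_volume_pos)
  show "0 < face_area f" if "E \<in> elems T" "f \<in> faces T E"
    using local_faces that by (simp add: face_area_pos)
  show "spd_on (faces T E) (M E)" if "E \<in> elems T"
    using mimetic that by (simp add: mimetic_matrices_def)
qed

lemma interior_face_two_elems:
  assumes "E1 \<in> elems T" "f \<in> faces T E1" "\<not> f \<subseteq> frontier \<Omega>"
  obtains E2 where "E2 \<in> elems T" "f \<in> faces T E2" "E1 \<noteq> E2" "{E\<in>elems T. f \<in> faces T E} = {E1, E2}"
proof -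
  have "\<forall>E\<in>elems T. \<forall>f\<in>faces T E. f \<subseteq> frontier \<Omega> \<or>
          (rel_interior f \<subseteq> \<Omega> \<and> card {E'\<in>elems T. f \<in> faces T E'} = 2)"
    using mesh unfolding polytopal_mesh_def by (elim conjE)
  from this[rule_format, OF assms(1,2)] assms(3) have "card {E'\<in>elems T. f \<in> faces T E'} = 2"
    by simp
  then obtain A B where AB: "{E'\<in>elems T. f \<in> faces T E'} = {A, B}" "A \<noteq> B"
    by (auto simp: card_2_iff)
  have "E1 \<in> {A, B}" using assms unfolding AB(1)[symmetric] by simp
  then obtain E2 where E2: "{A, B} = {E1, E2}" "E1 \<noteq> E2"
    using AB(2) by (metis empty_iff insert_commute insert_iff)
  have "E2 \<in> {E'\<in>elems T. f \<in> faces T E'}" unfolding AB(1) E2(1) by simp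
  hence "E2 \<in> elems T" "f \<in> faces T E2" by auto
  thus ?thesis by (rule that[OF _ _ E2(2) trans[OF AB(1) E2(1)]])
qed

lemma flux_opposite:
  assumes "p \<in> Fh3 \<Omega> T" "E1 \<in> elems T" "E2 \<in> elems T" "E1 \<noteq> E2" "f \<in> faces T E1 \<inter> faces T E2"
  shows "p E2 f = - p E1 f"
proof -
  have "(\<lambda>E f. p E f $ u) \<in> Fh \<Omega> T" for u using assms(1) by (simp add: Fh3_def)
  from this[unfolded Fh_def mem_Collect_eq, THEN conjunct2, THEN conjunct1, rule_format, OF assms(2-5)]
  have "p E1 f $ u + p E2 f $ u = 0" for u .
  thus ?thesis by (simp add: vec_eq_iff add_eq_0_iff)
qed

lemma flux_boundary:
  assumes "p \<in> Fh3 \<Omega> T" "E \<in> elems T" "f \<in> faces T E" "f \<subseteq> frontier \<Omega>"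
  shows "p E f = 0"
proof -
  have "(\<lambda>E f. p E f $ u) \<in> Fh \<Omega> T" for u using assms(1) by (simp add: Fh3_def)
  from this[unfolded Fh_def mem_Collect_eq, THEN conjunct2, THEN conjunct2, rule_format, OF assms(2-4)]
  have "p E f $ u = 0" for u .
  thus ?thesis by (simp add: vec_eq_iff)
qed

lemma innerQ_DIV:
  "innerQ T v (DIV T q) = (\<Sum>E\<in>elems T. \<Sum>f\<in>faces T E. face_area f * (v E \<bullet> q E f))"
  unfolding innerQ_inner
proof (rule sum.cong[OF refl])
  fix E assume E: "E \<in> elems T"
  show "elem_volume E * (v E \<bullet> DIV T q E) = (\<Sum>f\<in>faces T E. face_area f * (v E \<bullet> q E f))"
    using E volume_pos[OF E] by (simp add: DIV_def inner_sum_right)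
qed

text \<open>The two contributions of an interior face cancel by flux continuity, and a boundary face carries
  no flux.\<close>

lemma trace_flux_orthogonal:
  assumes \<mu>: "face_trace \<Omega> T \<mu>" and p: "p \<in> Fh3 \<Omega> T"
  shows "(\<Sum>E\<in>elems T. \<Sum>f\<in>faces T E. face_area f * (\<mu> E f \<bullet> p E f)) = 0"
proof -
  define F where "F = (\<Union>E\<in>elems T. faces T E)"
  have finF: "finite F" unfolding F_def using finite_elems finite_faces by blast
  have "(\<Sum>E\<in>elems T. \<Sum>f\<in>faces T E. face_area f * (\<mu> E f \<bullet> p E f))
      = (\<Sum>E\<in>elems T. \<Sum>f\<in>{f. f \<in> F \<and> f \<in> faces T E}. face_area f * (\<mu> E f \<bullet> p E f))"
    by (intro sum.cong refl) (auto simp: F_def)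
  also have "\<dots> = (\<Sum>f\<in>F. \<Sum>E\<in>{E\<in>elems T. f \<in> faces T E}. face_area f * (\<mu> E f \<bullet> p E f))"
    by (rule sum.swap_restrict[OF finite_elems finF])
  also have "\<dots> = 0"
  proof (rule sum.neutral, rule ballI)
    fix f assume "f \<in> F"
    then obtain E1 where E1: "E1 \<in> elems T" "f \<in> faces T E1" by (auto simp: F_def)
    show "(\<Sum>E\<in>{E\<in>elems T. f \<in> faces T E}. face_area f * (\<mu> E f \<bullet> p E f)) = 0"
    proof (cases "f \<subseteq> frontier \<Omega>")
      case True
      thus ?thesis using flux_boundary[OF p] by (intro sum.neutral) auto
    next
      case False
      obtain E2 where E2: "E2 \<in> elems T" "f \<in> faces T E2" "E1 \<noteq> E2"
          "{E\<in>elems T. f \<in> faces T E} = {E1, E2}"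
        using interior_face_two_elems[OF E1 False] .
      have "\<mu> E2 f = \<mu> E1 f" using \<mu> E1 E2 False unfolding face_trace_def by blast
      moreover have "p E2 f = - p E1 f"
        using flux_opposite[OF p E1(1) E2(1,3)] E1(2) E2(2) by blast
      ultimately show ?thesis unfolding E2(4) using E2(3) by simp
    qed
  qed
  finally show ?thesis .
qed

text \<open>Weak duality. By orthogonality, \<open>\<mu>\<close> can be subtracted from \<open>v\<close> in the definition of the gradient
  \<open>p\<close>, tested with \<open>p\<close> itself. Young's inequality in each element then bounds \<open>2 [p, p]\<close> by the hybrid
  energy plus \<open>[p, p]\<close>.\<close>

lemma energy_le_hybrid:
  assumes "face_trace \<Omega> T \<mu>"
  shows "innerF T M (GRAD \<Omega> T M v) (GRAD \<Omega> T M v) \<le> hybrid_energy T M v \<mu>"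
proof -
  let ?p = "GRAD \<Omega> T M v"
  let ?y = "\<lambda>E f. face_area f *\<^sub>R (\<mu> E f - v E)"
  have p: "?p \<in> Fh3 \<Omega> T" by (rule GRAD_in[OF mesh mimetic])
  have "innerF T M ?p ?p = - innerQ T v (DIV T ?p)"
    using GRAD_adjoint[OF mesh mimetic p] by simp
  also have "\<dots> = (\<Sum>E\<in>elems T. \<Sum>f\<in>faces T E. ?y E f \<bullet> ?p E f)"
    using trace_flux_orthogonal[OF assms p]
    by (simp add: innerQ_DIV inner_diff_left right_diff_distrib sum_subtractf)
  finally have "2 * innerF T M ?p ?p = (\<Sum>E\<in>elems T. 2 * (\<Sum>f\<in>faces T E. ?y E f \<bullet> ?p E f))"
    by (simp add: sum_distrib_left)
  also have "\<dots> \<le> (\<Sum>E\<in>elems T. vec_form (faces T E) (inverse_on (faces T E) (M E)) (?y E) (?y E)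
                     + vec_form (faces T E) (M E) (?p E) (?p E))"
    by (intro sum_mono spd_Young finite_faces local_spd)
  also have "\<dots> = hybrid_energy T M v \<mu> + innerF T M ?p ?p"
    by (simp add: sum.distrib hybrid_energy_def innerF_vec_form)
  finally show ?thesis by simp
qed

text \<open>These fluxes across a single interior face are the test fluxes that make the minimising face
  values agree on its two sides.\<close>

lemma interior_flux_in_Fh3:
  assumes E: "E1 \<in> elems T" "E2 \<in> elems T" "E1 \<noteq> E2"
    and f: "f \<in> faces T E1" "f \<in> faces T E2" "\<not> f \<subseteq> frontier \<Omega>"
  shows "(\<lambda>E g. if g = f \<and> E = E1 then a else if g = f \<and> E = E2 then - a else 0) \<in> Fh3 \<Omega> T"
    (is "?q \<in> _")
proof -
  obtain E' where "{E\<in>elems T. f \<in> faces T E} = {E1, E'}"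
    using interior_face_two_elems[OF E(1) f(1,3)] .
  hence only: "E = E1 \<or> E = E2" if "E \<in> elems T" "f \<in> faces T E" for E
    using that E f by blast
  have outside: "?q A g $ u = 0" if "\<not> (A \<in> elems T \<and> g \<in> faces T A)" for A g u
    using that E f by auto
  have continuity: "?q A g $ u + ?q B g $ u = 0"
    if "A \<in> elems T" "B \<in> elems T" "A \<noteq> B" "g \<in> faces T A \<inter> faces T B" for A B g u
    using that only[of A] only[of B] E(3) by auto
  have boundary: "?q A g $ u = 0" if "g \<subseteq> frontier \<Omega>" for A g u
    using that f(3) by auto
  show ?thesis
    unfolding Fh3_def Fh_def mem_Collect_eq
    by (intro allI conjI ballI impI) (rule outside continuity boundary, assumption+)+
qed

text \<open>Strong duality. Equality in Young's inequality forces \<open>\<bar>f\<bar> (\<mu> - v) = M p\<close> on each face of each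
  element; this determines \<open>\<mu>\<close> because areas are positive. Testing the definition of the gradient
  with a flux across a single interior face shows that the values from both sides agree.\<close>

lemma energy_eq_hybrid:
  obtains \<mu> where "face_trace \<Omega> T \<mu>"
    and "hybrid_energy T M v \<mu> = innerF T M (GRAD \<Omega> T M v) (GRAD \<Omega> T M v)"
proof -
  let ?p = "GRAD \<Omega> T M v"
  define r where "r E f = (\<Sum>g\<in>faces T E. M E f g *\<^sub>R ?p E g)" for E f
  \<comment> \<open>solves \<open>\<bar>f\<bar> (\<mu> - v) = M p\<close>, the equality case of Young's inequality\<close>
  define \<mu> where "\<mu> E f = v E + (1 / face_area f) *\<^sub>R r E f" for E f
  have r: "(\<Sum>E\<in>elems T. \<Sum>f\<in>faces T E. (face_area f *\<^sub>R v E + r E f) \<bullet> q E f) = 0"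
    if q: "q \<in> Fh3 \<Omega> T" for q
  proof -
    have "innerF T M ?p q = (\<Sum>E\<in>elems T. \<Sum>f\<in>faces T E. r E f \<bullet> q E f)"
      unfolding innerF_vec_form vec_form_left r_def
    proof (intro sum.cong refl, goal_cases)
      case (1 E f)
      have "(\<Sum>g\<in>faces T E. M E g f *\<^sub>R ?p E g) = (\<Sum>g\<in>faces T E. M E f g *\<^sub>R ?p E g)"
        using local_spd[OF 1(1)] 1(2) by (intro sum.cong) (auto simp: spd_on_def)
      thus ?case by simp
    qed
    thus ?thesis
      using GRAD_adjoint[OF mesh mimetic q, of v]
      by (simp add: innerQ_DIV inner_add_left sum.distrib)
  qed
  have \<mu>_area: "face_area f *\<^sub>R (\<mu> E f - v E) = r E f" if "E \<in> elems T" "f \<in> faces T E" for E f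
    using area_pos[OF that] by (simp add: \<mu>_def)
  have "\<mu> E1 f = \<mu> E2 f"
    if E: "E1 \<in> elems T" "E2 \<in> elems T"
      and f: "f \<in> faces T E1" "f \<in> faces T E2" "\<not> f \<subseteq> frontier \<Omega>" for E1 E2 f
  proof (cases "E1 = E2")
    case False
    define s where "s E = face_area f *\<^sub>R v E + r E f" for E
    \<comment> \<open>the jump itself, sent as a flux across \<open>f\<close>: the test returns its squared length\<close>
    define a where "a = s E1 - s E2"
    define q where "q = (\<lambda>E g. if g = f \<and> E = E1 then a else if g = f \<and> E = E2 then - a else 0)"
    have q_sum: "(\<Sum>g\<in>faces T E. (face_area g *\<^sub>R v E + r E g) \<bullet> q E g)
                  = (if E = E1 then s E1 \<bullet> a else 0) + (if E = E2 then - (s E2 \<bullet> a) else 0)"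
      if "E \<in> elems T" for E
    proof -
      have "(\<Sum>g\<in>faces T E. (face_area g *\<^sub>R v E + r E g) \<bullet> q E g)
              = (\<Sum>g\<in>faces T E. if g = f then s E \<bullet> q E f else 0)"
        by (intro sum.cong refl) (auto simp: q_def s_def)
      also have "\<dots> = (if f \<in> faces T E then s E \<bullet> q E f else 0)"
        using finite_faces[OF that] by simp
      also have "\<dots> = (if E = E1 then s E1 \<bullet> a else 0) + (if E = E2 then - (s E2 \<bullet> a) else 0)"
        using f(1,2) False by (auto simp: q_def)
      finally show ?thesis .
    qed
    have "0 = (\<Sum>E\<in>elems T. \<Sum>g\<in>faces T E. (face_area g *\<^sub>R v E + r E g) \<bullet> q E g)"
      unfolding q_def by (rule r[OF interior_flux_in_Fh3[OF E False f], symmetric])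
    also have "\<dots> = (\<Sum>E\<in>elems T. (if E = E1 then s E1 \<bullet> a else 0) + (if E = E2 then - (s E2 \<bullet> a) else 0))"
      by (intro sum.cong refl q_sum)
    also have "\<dots> = a \<bullet> a"
      using finite_elems E by (simp add: sum.distrib a_def inner_diff_left)
    finally have "s E1 = s E2" by (simp add: a_def)
    moreover have "\<mu> E f = (1 / face_area f) *\<^sub>R s E" for E
      using area_pos[OF E(1) f(1)] by (simp add: \<mu>_def s_def scaleR_add_right)
    ultimately show ?thesis by simp
  qed simp
  hence "face_trace \<Omega> T \<mu>"
    unfolding face_trace_def by (intro ballI impI) (elim IntE)
  moreover have "hybrid_energy T M v \<mu> = innerF T M ?p ?p"
    unfolding hybrid_energy_def innerF_vec_form
  proof (rule sum.cong[OF refl])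
    fix E assume E: "E \<in> elems T"
    show "vec_form (faces T E) (inverse_on (faces T E) (M E))
            (\<lambda>f. face_area f *\<^sub>R (\<mu> E f - v E)) (\<lambda>f. face_area f *\<^sub>R (\<mu> E f - v E))
          = vec_form (faces T E) (M E) (?p E) (?p E)"
      by (rule spd_Young_eq[OF finite_faces[OF E] local_spd[OF E]])
         (simp only: \<mu>_area[OF E] r_def)
  qed
  ultimately show ?thesis by (rule that)
qed

end

section \<open>Contraction of the energy\<close>

text \<open>The two conditions are the sign conditions of \<open>vec_form_contract\<close> for the matrix with entries
  \<open>\<bar>f\<bar> W\<^sub>f\<^sub>g \<bar>g\<bar>\<close>: its off-diagonal entries are nonpositive, and its row sums are \<open>\<bar>f\<bar> (W C e)\<^sub>f\<close>.\<close>

locale monotone_mimetic_mesh = mimetic_mesh +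
  assumes M_matrix: "E \<in> elems T \<Longrightarrow> M_matrix_on (faces T E) (inverse_on (faces T E) (M E))"
    and positive: "E \<in> elems T \<Longrightarrow> f \<in> faces T E \<Longrightarrow>
          0 < matvec_on (faces T E) (inverse_on (faces T E) (M E))
                (matvec_on (faces T E) area_matrix (\<lambda>_. 1)) f"
begin

text \<open>The edges of the local graph join face values with each other and with the element value, as
  \<open>(\<mu>\<^sub>f - v) - (\<mu>\<^sub>g - v) = \<mu>\<^sub>f - \<mu>\<^sub>g\<close>. A 1-Lipschitz map lengthens no edge.\<close>

lemma hybrid_energy_contract:
  assumes \<phi>: "\<And>x y. norm (\<phi> x - \<phi> y) \<le> norm (x - y)"
  shows "hybrid_energy T M (\<lambda>E. \<phi> (v E)) (\<lambda>E f. \<phi> (\<mu> E f)) \<le> hybrid_energy T M v \<mu>"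
  unfolding hybrid_energy_def
proof (rule sum_mono)
  fix E assume E: "E \<in> elems T"
  let ?I = "faces T E"
  let ?W = "inverse_on ?I (M E)"
  define c where "c f g = face_area f * ?W f g * face_area g" for f g
  have weighted: "vec_form ?I ?W (\<lambda>f. face_area f *\<^sub>R x f) (\<lambda>f. face_area f *\<^sub>R x f)
                    = vec_form ?I c x x" for x :: "'a set \<Rightarrow> real^3"
    unfolding vec_form_def c_def by (intro sum.cong refl) simp
  have area_vec: "matvec_on ?I area_matrix (\<lambda>_. 1) g = face_area g" if "g \<in> ?I" for g
    using that finite_faces[OF E] by (simp add: matvec_on_def area_matrix_def diag_matrix_def)
  show "vec_form ?I ?W (\<lambda>f. face_area f *\<^sub>R (\<phi> (\<mu> E f) - \<phi> (v E))) (\<lambda>f. face_area f *\<^sub>R (\<phi> (\<mu> E f) - \<phi> (v E)))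
      \<le> vec_form ?I ?W (\<lambda>f. face_area f *\<^sub>R (\<mu> E f - v E)) (\<lambda>f. face_area f *\<^sub>R (\<mu> E f - v E))"
    unfolding weighted
  proof (rule vec_form_contract)
    show "\<forall>f\<in>?I. \<forall>g\<in>?I. c f g = c g f"
      using spd_inverse(2)[OF finite_faces[OF E] local_spd[OF E]] by (simp add: c_def mult_ac)
  next
    fix f g assume fg: "f \<in> ?I" "g \<in> ?I" "f \<noteq> g"
    have "?W f g \<le> 0" using M_matrix[OF E] fg by (auto simp: M_matrix_on_def)
    thus "c f g \<le> 0"
      using area_pos[OF E fg(1)] area_pos[OF E fg(2)] by (simp add: c_def mult_le_0_iff)
  next
    fix f assume f: "f \<in> ?I"
    have "(\<Sum>g\<in>?I. c f g) = face_area f * matvec_on ?I ?W (matvec_on ?I area_matrix (\<lambda>_. 1)) f"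
      by (simp add: c_def matvec_on_def[of ?I ?W] area_vec sum_distrib_left mult.assoc)
    thus "0 \<le> (\<Sum>g\<in>?I. c f g)"
      using area_pos[OF E f] positive[OF E f] by simp
  qed (simp_all add: \<phi>)
qed

text \<open>Apply \<open>\<phi>\<close> to \<open>v\<close> and to its optimal face values. The image of the latter is an admissible competitor
  for the minimum that is the energy of \<open>\<phi> v\<close>.\<close>

theorem energy_contract:
  assumes \<phi>: "\<And>x y. norm (\<phi> x - \<phi> y) \<le> norm (x - y)"
  shows "normF T M (GRAD \<Omega> T M (\<lambda>E. \<phi> (v E))) \<le> normF T M (GRAD \<Omega> T M v)"
proof -
  obtain \<mu> where \<mu>: "face_trace \<Omega> T \<mu>"
    and eq: "hybrid_energy T M v \<mu> = innerF T M (GRAD \<Omega> T M v) (GRAD \<Omega> T M v)"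
    by (rule energy_eq_hybrid)
  have "face_trace \<Omega> T (\<lambda>E f. \<phi> (\<mu> E f))"
    unfolding face_trace_def
  proof (intro ballI impI)
    fix E1 E2 f
    assume "E1 \<in> elems T" "E2 \<in> elems T" "f \<in> faces T E1 \<inter> faces T E2" "\<not> f \<subseteq> frontier \<Omega>"
    from \<mu>[unfolded face_trace_def, rule_format, OF this]
    show "\<phi> (\<mu> E1 f) = \<phi> (\<mu> E2 f)" by simp
  qed
  note energy_le_hybrid[OF this, of "\<lambda>E. \<phi> (v E)"]
  also note hybrid_energy_contract[OF \<phi>, of v \<mu>]
  finally show ?thesis unfolding normF_def eq by simp
qed

end

section \<open>Pointwise properties of the scheme\<close>

text \<open>The equation says \<open>v = m \<times> z - \<alpha> z'\<close>, where \<open>z' = z - (m \<bullet> z) m\<close> is the tangential part of \<open>z\<close>. The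
  vectors \<open>m \<times> z\<close> and \<open>z'\<close> are tangential, mutually orthogonal and of equal length. Therefore
  \<open>v \<bullet> z = - \<alpha> \<bar>z'\<bar>\<^sup>2\<close> and \<open>\<bar>v\<bar>\<^sup>2 = (1 + \<alpha>\<^sup>2) \<bar>z'\<bar>\<^sup>2\<close>.\<close>

lemma llg_update_orthogonal:
  fixes m v z :: "real^3"
  assumes m: "norm m = 1"
    and eq: "v + \<alpha> *\<^sub>R z = cross3 m z + (\<alpha> * (m \<bullet> z)) *\<^sub>R m"
  shows "m \<bullet> v = 0" and "(1 + \<alpha>\<^sup>2) * (v \<bullet> z) = - \<alpha> * (v \<bullet> v)"
proof -
  have mm: "m \<bullet> m = 1" using m by (simp add: dot_square_norm)
  have v: "v = cross3 m z + (\<alpha> * (m \<bullet> z)) *\<^sub>R m - \<alpha> *\<^sub>R z"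
    using eq by (simp add: algebra_simps)
  show "m \<bullet> v = 0"
    unfolding v by (simp add: inner_add_right inner_diff_right dot_cross_self mm)
  have cc: "cross3 m z \<bullet> cross3 m z = z \<bullet> z - (m \<bullet> z)\<^sup>2"
    using norm_cross_dot[of m z] m by (simp add: power2_norm_eq_inner)
  have vz: "v \<bullet> z = - \<alpha> * (z \<bullet> z - (m \<bullet> z)\<^sup>2)"
    unfolding v by (simp add: inner_add_left inner_diff_left dot_cross_self power2_eq_square algebra_simps)
  have vv: "v \<bullet> v = (1 + \<alpha>\<^sup>2) * (z \<bullet> z - (m \<bullet> z)\<^sup>2)"
    unfolding v
    by (simp add: inner_add_left inner_diff_left inner_add_right inner_diff_right dot_cross_self
        cc mm inner_commute[of z m] power2_eq_square algebra_simps)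
  show "(1 + \<alpha>\<^sup>2) * (v \<bullet> z) = - \<alpha> * (v \<bullet> v)"
    unfolding vz vv by simp
qed

text \<open>This extends normalisation to a 1-Lipschitz map on the whole space. The extension is needed since
  face values may lie inside the unit ball even if all element values lie outside.\<close>

lemma closest_point_unit_ball:
  fixes x :: "'a::euclidean_space"
  assumes "1 \<le> norm x"
  shows "closest_point (cball 0 1) x = (1 / norm x) *\<^sub>R x"
proof (rule closest_point_unique[symmetric])
  have x: "x \<noteq> 0" using assms by auto
  show "\<forall>z\<in>cball 0 1. dist x ((1 / norm x) *\<^sub>R x) \<le> dist x z"
  proof
    fix z :: 'a assume "z \<in> cball 0 1"
    hence z: "norm z \<le> 1" by simp
    have "x - (1 / norm x) *\<^sub>R x = (1 - 1 / norm x) *\<^sub>R x" by (simp add: algebra_simps)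
    hence "dist x ((1 / norm x) *\<^sub>R x) = \<bar>1 - 1 / norm x\<bar> * norm x" by (simp add: dist_norm)
    also have "\<dots> = norm x - 1" using assms x by (simp add: field_simps)
    also have "\<dots> \<le> dist x z" using norm_triangle_ineq2[of x z] z by (simp add: dist_norm)
    finally show "dist x ((1 / norm x) *\<^sub>R x) \<le> dist x z" .
  qed
qed (use assms in auto)

section \<open>Energy balance of one time step\<close>

lemma normF_le_iff:
  "normF T M p \<le> normF T M q \<longleftrightarrow> innerF T M p p \<le> innerF T M q q"
  by (simp add: normF_def)

lemma Qh3_iff: "v \<in> Qh3 T \<longleftrightarrow> (\<forall>E. E \<notin> elems T \<longrightarrow> v E = 0)"
  unfolding Qh3_def Qh_def mem_Collect_eq vec_eq_iff zero_index by blast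

context mimetic_mesh
begin

lemma innerF_commute: "innerF T M p q = innerF T M q p"
proof -
  have "vec_form (faces T E) (M E) (p E) (q E) = vec_form (faces T E) (M E) (q E) (p E)"
    if "E \<in> elems T" for E
    using local_spd[OF that] unfolding vec_form_def
    by (subst sum.swap, intro sum.cong refl) (simp add: inner_commute spd_on_def)
  thus ?thesis unfolding innerF_vec_form by (rule sum.cong[OF refl])
qed

lemma innerF_nonneg: "0 \<le> innerF T M p p"
  unfolding innerF_vec_form by (intro sum_nonneg vec_form_nonneg local_spd)

lemma innerQ_nonneg: "0 \<le> innerQ T v v"
  unfolding innerQ_inner using volume_pos
  by (intro sum_nonneg mult_nonneg_nonneg) (auto intro: less_imp_le)

lemma energy_update:
  "innerF T M (GRAD \<Omega> T M (\<lambda>E. m E + k *\<^sub>R v E)) (GRAD \<Omega> T M (\<lambda>E. m E + k *\<^sub>R v E))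
     = innerF T M (GRAD \<Omega> T M m) (GRAD \<Omega> T M m)
       + 2 * k * innerF T M (GRAD \<Omega> T M v) (GRAD \<Omega> T M m)
       + k\<^sup>2 * innerF T M (GRAD \<Omega> T M v) (GRAD \<Omega> T M v)"
proof -
  let ?m = "GRAD \<Omega> T M m" and ?v = "GRAD \<Omega> T M v"
  let ?s = "\<lambda>E f. ?m E f + k *\<^sub>R ?v E f"
  have s: "GRAD \<Omega> T M (\<lambda>E. m E + k *\<^sub>R v E) = ?s"
    using GRAD_linear[OF mesh mimetic, of 1 m k v] by simp
  have left: "innerF T M ?s q = innerF T M ?m q + k * innerF T M ?v q" for q
    by (simp only: innerF_add_left innerF_scale_left)
  have "innerF T M ?s ?s = innerF T M ?s ?m + k * innerF T M ?s ?v"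
    unfolding left[of ?s] innerF_commute[of ?m ?s] innerF_commute[of ?v ?s] ..
  also have "\<dots> = innerF T M ?m ?m + 2 * k * innerF T M ?v ?m + k\<^sup>2 * innerF T M ?v ?v"
    unfolding left innerF_commute[of ?m ?v] by (simp add: algebra_simps power2_eq_square)
  finally show ?thesis unfolding s .
qed

text \<open>By duality of divergence and gradient, \<open>a v w\<close> is the inner product of \<open>v\<close> and \<open>z\<close>, to which
  the pointwise identity applies.\<close>

lemma dissipation:
  fixes m v w :: "'a set \<Rightarrow> real^3"
  assumes unit: "\<forall>E\<in>elems T. norm (m E) = 1"
    and z: "z = DIV T (\<lambda>E f. - GRAD \<Omega> T M w E f)"
    and eq: "\<forall>E\<in>elems T.
      v E + \<alpha> *\<^sub>R z E = cross3 (m E) (z E) + (\<alpha> * (m E \<bullet> z E)) *\<^sub>R m E"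
  shows "(1 + \<alpha>\<^sup>2) * innerF T M (GRAD \<Omega> T M v) (GRAD \<Omega> T M w) = - \<alpha> * innerQ T v v"
proof -
  let ?v = "GRAD \<Omega> T M v" and ?w = "GRAD \<Omega> T M w"
  have q: "(\<lambda>E f. - ?w E f) \<in> Fh3 \<Omega> T"
    using Fh3_lincomb[of ?w \<Omega> T ?w "-1" 0] GRAD_in[OF mesh mimetic] by simp
  have "innerF T M ?v ?w = innerF T M ?w ?v" by (rule innerF_commute)
  also have "\<dots> = - innerF T M (\<lambda>E f. - ?w E f) ?v"
    using innerF_scale_left[of T M "-1" ?w] by simp
  also have "\<dots> = - innerF T M ?v (\<lambda>E f. - ?w E f)" by (simp add: innerF_commute)
  also have "\<dots> = innerQ T v z"
    unfolding z using GRAD_adjoint[OF mesh mimetic q, of v] by simp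
  finally have "(1 + \<alpha>\<^sup>2) * innerF T M ?v ?w
      = (\<Sum>E\<in>elems T. elem_volume E * ((1 + \<alpha>\<^sup>2) * (v E \<bullet> z E)))"
    by (simp add: innerQ_inner sum_distrib_left mult_ac)
  also have "\<dots> = (\<Sum>E\<in>elems T. elem_volume E * (- \<alpha> * (v E \<bullet> v E)))"
    by (intro sum.cong refl)
       (simp only: llg_update_orthogonal(2)[OF bspec[OF unit] bspec[OF eq]])
  also have "\<dots> = - \<alpha> * innerQ T v v"
    by (simp add: innerQ_inner sum_distrib_left sum_negf mult_ac)
  finally show ?thesis .
qed

text \<open>With \<open>a v w\<close> for the inner product of the gradients, expand the energy around the state where the
  flux is taken. For \<open>\<theta> = 0\<close>, the energy changes by \<open>k (2 a v m + k a v v)\<close>, which is nonpositive by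
  \<open>cfl\<close>. For \<open>\<theta> = 1\<close>, it changes by \<open>2 k a v mhat - k\<^sup>2 a v v\<close>, and both terms have the right
  sign.\<close>

lemma theta_step_energy:
  fixes m v mhat :: "'a set \<Rightarrow> real^3"
  assumes alpha: "\<alpha> > 0" and k: "k > 0"
    and mhat: "mhat = (\<lambda>E. m E + k *\<^sub>R v E)"
    and theta: "\<theta> = 0 \<or> \<theta> = 1"
    and diss: "(1 + \<alpha>\<^sup>2) * innerF T M (GRAD \<Omega> T M v) (GRAD \<Omega> T M (\<lambda>E. m E + \<theta> *\<^sub>R (mhat E - m E)))
                 = - \<alpha> * innerQ T v v"
    and cfl: "\<theta> = 0 \<longrightarrow> (1 + \<alpha>\<^sup>2) * k * innerF T M (GRAD \<Omega> T M v) (GRAD \<Omega> T M v) \<le> 2 * \<alpha> * innerQ T v v"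
  shows "normF T M (GRAD \<Omega> T M mhat) \<le> normF T M (GRAD \<Omega> T M m)"
  unfolding normF_le_iff
proof -
  let ?a = "\<lambda>v w. innerF T M (GRAD \<Omega> T M v) (GRAD \<Omega> T M w)"
  have pos: "0 < 1 + \<alpha>\<^sup>2" by (simp add: add_pos_nonneg)
  show "?a mhat mhat \<le> ?a m m"
  proof (cases "\<theta> = 0")
    case True
    hence "(1 + \<alpha>\<^sup>2) * (2 * ?a v m + k * ?a v v) \<le> 0"
      using diss cfl by (simp add: distrib_left mult.assoc mult.left_commute[of _ 2])
    hence "2 * ?a v m + k * ?a v v \<le> 0" using pos by (simp add: mult_le_0_iff)
    hence "k * (2 * ?a v m + k * ?a v v) \<le> 0" using k by (simp add: mult_le_0_iff)
    moreover have "?a mhat mhat = ?a m m + k * (2 * ?a v m + k * ?a v v)"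
      unfolding mhat energy_update by (simp add: algebra_simps power2_eq_square)
    ultimately show ?thesis by simp
  next
    case False
    hence "(1 + \<alpha>\<^sup>2) * ?a v mhat = - \<alpha> * innerQ T v v" using diss theta by simp
    also have "\<dots> \<le> 0" using alpha innerQ_nonneg by simp
    finally have "?a v mhat \<le> 0" using pos by (simp add: mult_le_0_iff)
    hence "2 * k * ?a v mhat \<le> 0" using k by (simp add: mult_le_0_iff)
    moreover have "?a m m = ?a mhat mhat - 2 * k * ?a v mhat + k\<^sup>2 * ?a v v"
      using energy_update[of mhat "- k" v] by (simp add: mhat)
    moreover have "0 \<le> k\<^sup>2 * ?a v v" by (simp add: innerF_nonneg)
    ultimately show ?thesis by simp
  qed
qed

end

context monotone_mimetic_mesh
begin

lemma renormalise_energy: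
  assumes Qh3: "v \<in> Qh3 T" "w \<in> Qh3 T"
    and ge1: "\<forall>E\<in>elems T. 1 \<le> norm (v E)"
    and w: "\<forall>E\<in>elems T. w E = (1 / norm (v E)) *\<^sub>R v E"
  shows "normF T M (GRAD \<Omega> T M w) \<le> normF T M (GRAD \<Omega> T M v)"
proof -
  let ?\<phi> = "closest_point (cball (0::real^3) 1)"
  \<comment> \<open>also outside the mesh, where both sides are \<open>0\<close>\<close>
  have "w = (\<lambda>E. ?\<phi> (v E))"
  proof
    fix E show "w E = ?\<phi> (v E)"
    proof (cases "E \<in> elems T")
      case True
      thus ?thesis using w ge1 by (simp add: closest_point_unit_ball)
    next
      case False
      hence "v E = 0" "w E = 0" using Qh3 by (simp_all add: Qh3_iff)
      thus ?thesis by (simp add: closest_point_self)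
    qed
  qed
  moreover have "norm (?\<phi> x - ?\<phi> y) \<le> norm (x - y)" for x y
    using closest_point_lipschitz[of "cball (0::real^3) 1" x y] by (simp add: dist_norm)
  ultimately show ?thesis using energy_contract[of ?\<phi> v] by simp
qed

lemma theta_step_stable:
  assumes alpha: "\<alpha> > 0" and k: "k > 0" and theta: "\<theta> = 0 \<or> \<theta> = 1"
    and cfl: "\<theta> = 0 \<longrightarrow> (\<forall>v\<in>Qh3 T.
      (1 + \<alpha>\<^sup>2) * k * innerF T M (GRAD \<Omega> T M v) (GRAD \<Omega> T M v) \<le> 2 * \<alpha> * innerQ T v v)"
    and m: "m \<in> Qh3 T" and unit: "\<forall>E\<in>elems T. norm (m E) = 1"
    and step: "theta_step \<Omega> T M \<alpha> \<theta> k m mhat m'"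
  shows "m' \<in> Qh3 T" and "\<forall>E\<in>elems T. norm (m' E) = 1"
    and "normF T M (GRAD \<Omega> T M m') \<le> normF T M (GRAD \<Omega> T M m)"
proof -
  define v where "v E = (1 / k) *\<^sub>R (mhat E - m E)" for E
  define w where "w = (\<lambda>E. m E + \<theta> *\<^sub>R (mhat E - m E))"
  define z where "z = DIV T (\<lambda>E f. - GRAD \<Omega> T M w E f)"
  have mhat_Qh3: "mhat \<in> Qh3 T" and m'_Qh3: "m' \<in> Qh3 T"
    and eq: "\<forall>E\<in>elems T.
      v E + \<alpha> *\<^sub>R z E = cross3 (m E) (z E) + (\<alpha> * (m E \<bullet> z E)) *\<^sub>R m E"
    and m': "\<forall>E\<in>elems T. m' E = (1 / norm (mhat E)) *\<^sub>R mhat E"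
    using step by (simp_all add: theta_step_def Let_def v_def w_def z_def)
  have mhat: "mhat = (\<lambda>E. m E + k *\<^sub>R v E)" using k by (simp add: v_def)
  have ge1: "\<forall>E\<in>elems T. 1 \<le> norm (mhat E)"
  proof
    fix E assume E: "E \<in> elems T"
    have "m E \<bullet> v E = 0" by (rule llg_update_orthogonal(1)[OF bspec[OF unit E] bspec[OF eq E]])
    hence "(norm (mhat E))\<^sup>2 = (norm (m E))\<^sup>2 + (norm (k *\<^sub>R v E))\<^sup>2"
      unfolding mhat by (intro norm_add_Pythagorean) (simp add: orthogonal_def)
    also have "\<dots> \<ge> 1\<^sup>2" using unit E by simp
    finally show "1 \<le> norm (mhat E)" by (rule power2_le_imp_le) simp
  qed
  show "m' \<in> Qh3 T" by (rule m'_Qh3)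
  show "\<forall>E\<in>elems T. norm (m' E) = 1"
  proof
    fix E assume E: "E \<in> elems T"
    have "norm (mhat E) \<noteq> 0" using bspec[OF ge1 E] by linarith
    thus "norm (m' E) = 1" by (simp add: bspec[OF m' E])
  qed
  have v_Qh3: "v \<in> Qh3 T" using m mhat_Qh3 by (simp add: v_def Qh3_iff)
  have "normF T M (GRAD \<Omega> T M m') \<le> normF T M (GRAD \<Omega> T M mhat)"
    by (rule renormalise_energy[OF mhat_Qh3 m'_Qh3 ge1 m'])
  also have "\<dots> \<le> normF T M (GRAD \<Omega> T M m)"
  proof (rule theta_step_energy[OF alpha k mhat theta])
    show "(1 + \<alpha>\<^sup>2) * innerF T M (GRAD \<Omega> T M v) (GRAD \<Omega> T M (\<lambda>E. m E + \<theta> *\<^sub>R (mhat E - m E)))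
            = - \<alpha> * innerQ T v v"
      using dissipation[OF unit z_def eq] unfolding w_def .
    show "\<theta> = 0 \<longrightarrow> (1 + \<alpha>\<^sup>2) * k * innerF T M (GRAD \<Omega> T M v) (GRAD \<Omega> T M v)
            \<le> 2 * \<alpha> * innerQ T v v"
      using cfl v_Qh3 by blast
  qed
  finally show "normF T M (GRAD \<Omega> T M m') \<le> normF T M (GRAD \<Omega> T M m)" .
qed

end

section \<open>Energy decay along the iterates\<close>

theorem theorem1:
  fixes \<Omega> :: "(real^'d) set"
    and H :: "real set"
    and T :: "real \<Rightarrow> (real^'d) mesh"
    and M :: "real \<Rightarrow> (real^'d) set \<Rightarrow> (real^'d) set \<Rightarrow> (real^'d) set \<Rightarrow> real"
    and m mhat :: "nat \<Rightarrow> (real^'d) set \<Rightarrow> real^3"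
    and c0 C0 C1 \<alpha> \<theta> k h :: real
    and J :: nat
  assumes dim: "CARD('d) = 2 \<or> CARD('d) = 3"
    and domain: "bounded_domain \<Omega>"
    and mesh: "\<And>h. h \<in> H \<Longrightarrow> polytopal_mesh \<Omega> (T h) \<and> mesh_size (T h) = h"
    and shape_regular: "shape_regular_family (T ` H)"
    and quasi_uniform: "quasi_uniform_family (T ` H)"
    and mimetic: "\<And>h. h \<in> H \<Longrightarrow> mimetic_matrices (T h) (M h)"
    and stable_const: "c0 > 0" "C0 > 0"
    and stable: "\<And>h. h \<in> H \<Longrightarrow> stable_matrices c0 C0 (T h) (M h)"
    and C1: "C1 > 0"
    and inverse_estimate: "\<And>h v. h \<in> H \<Longrightarrow> v \<in> Qh3 (T h) \<Longrightarrow>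
          (normF (T h) (M h) (GRAD \<Omega> (T h) (M h) v))\<^sup>2 \<le> C1 / h\<^sup>2 * (normQ (T h) v)\<^sup>2"
    and h: "h \<in> H"
    and M_matrix: "\<And>E. E \<in> elems (T h) \<Longrightarrow>
          M_matrix_on (faces (T h) E) (inverse_on (faces (T h) E) (M h E))"
    and positive: "\<And>E f. E \<in> elems (T h) \<Longrightarrow> f \<in> faces (T h) E \<Longrightarrow>
          0 < matvec_on (faces (T h) E) (inverse_on (faces (T h) E) (M h E))
                (matvec_on (faces (T h) E) area_matrix (\<lambda>_. 1)) f"
    and alpha: "\<alpha> > 0"
    and theta: "\<theta> = 0 \<or> \<theta> = 1"
    and time_step: "k > 0"
    and courant: "\<theta> = 0 \<Longrightarrow> k / h\<^sup>2 \<le> 2 * \<alpha> / (C1 * (1 + \<alpha>\<^sup>2))"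
    and initial: "m 0 \<in> Qh3 (T h)" "\<And>E. E \<in> elems (T h) \<Longrightarrow> norm (m 0 E) = 1"
    and scheme: "\<And>j. j < J \<Longrightarrow>
          theta_step \<Omega> (T h) (M h) \<alpha> \<theta> k (m j) (mhat (Suc j)) (m (Suc j))"
  shows "\<forall>j<J. normF (T h) (M h) (GRAD \<Omega> (T h) (M h) (m (Suc j)))
                 \<le> normF (T h) (M h) (GRAD \<Omega> (T h) (M h) (m j))"
proof -
  interpret monotone_mimetic_mesh \<Omega> "T h" "M h"
    by unfold_locales (simp_all only: mesh[OF h] mimetic[OF h] M_matrix positive)
  have cfl: "\<theta> = 0 \<longrightarrow> (\<forall>v\<in>Qh3 (T h).
      (1 + \<alpha>\<^sup>2) * k * innerF (T h) (M h) (GRAD \<Omega> (T h) (M h) v) (GRAD \<Omega> (T h) (M h) v)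
        \<le> 2 * \<alpha> * innerQ (T h) v v)"
  proof (intro impI ballI)
    fix v assume \<theta>: "\<theta> = 0" and v: "v \<in> Qh3 (T h)"
    have pos: "0 < C1 * (1 + \<alpha>\<^sup>2)" using C1 by (simp add: add_pos_nonneg)
    let ?a = "innerF (T h) (M h) (GRAD \<Omega> (T h) (M h) v) (GRAD \<Omega> (T h) (M h) v)"
    \<comment> \<open>the inverse estimate and the Courant condition combine to the stability condition of one step\<close>
    have "?a \<le> C1 / h\<^sup>2 * innerQ (T h) v v"
      using inverse_estimate[OF h v] by (simp add: normF_def normQ_def innerF_nonneg innerQ_nonneg)
    hence "(1 + \<alpha>\<^sup>2) * k * ?a \<le> (1 + \<alpha>\<^sup>2) * k * (C1 / h\<^sup>2 * innerQ (T h) v v)"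
      using time_step by (intro mult_left_mono) auto
    also have "\<dots> = (k / h\<^sup>2 * (C1 * (1 + \<alpha>\<^sup>2))) * innerQ (T h) v v" by simp
    also have "\<dots> \<le> 2 * \<alpha> * innerQ (T h) v v"
      using courant[OF \<theta>] pos by (intro mult_right_mono innerQ_nonneg) (simp add: pos_le_divide_eq)
    finally show "(1 + \<alpha>\<^sup>2) * k * ?a \<le> 2 * \<alpha> * innerQ (T h) v v" .
  qed
  note step = theta_step_stable[OF alpha time_step theta cfl]
  have iterates: "m j \<in> Qh3 (T h) \<and> (\<forall>E\<in>elems (T h). norm (m j E) = 1)" if "j \<le> J" for j
    using that
  proof (induction j)
    case 0
    show ?case using initial by simp
  next
    case (Suc j)
    hence j: "j < J" and "m j \<in> Qh3 (T h)" "\<forall>E\<in>elems (T h). norm (m j E) = 1" by simp_all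
    thus ?case using step(1,2)[OF _ _ scheme[OF j]] by blast
  qed
  show ?thesis
  proof (intro allI impI)
    fix j assume j: "j < J"
    hence "m j \<in> Qh3 (T h)" "\<forall>E\<in>elems (T h). norm (m j E) = 1" using iterates[of j] by simp_all
    thus "normF (T h) (M h) (GRAD \<Omega> (T h) (M h) (m (Suc j)))
            \<le> normF (T h) (M h) (GRAD \<Omega> (T h) (M h) (m j))"
      by (rule step(3)[OF _ _ scheme[OF j]])
  qed
qed

end
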